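(* There exists a constant $C>0$ such that, for any $\zeta\in[0,1]$, $\sigma\in(0,1]$, $T\ge1$ and $p\in[T^{-\zeta},1]$, $$\mathbb{E}\big(h_T(0)\big)\le C\,(\sigma pT^2)^{\frac{1}{2-\zeta}},$$ where $h_T(0)$ is the height at time $T$ above site $0$ in the Bernoulli ballistic deposition model with sticking parameter $p$, block height distribution $\mathrm{Bernoulli}(\sigma)$ and initial configuration $h_0\equiv0$.
   Context: Bernoulli ballistic deposition model with parameters $p,\sigma\in(0,1]$: let $\xi$ be a Poisson process on $\mathbb{Z}\times\mathbb{R}_+$ with intensity counting measure $\otimes$ Lebesgue measure. Each point $(x,t)\in\xi$ carries an independent mark $(\varepsilon(x,t),\eta(x,t))$, where $\varepsilon(x,t)\sim\mathrm{Bernoulli}(p)$ and $\eta(x,t)\sim\mathrm{Bernoulli}(\sigma)$ are independent. The heights $h_t(x)$, $x\in\mathbb{Z}$, $t\ge0$, satisfy $h_0\equiv0$; for each $x$, $t\mapsto h_t(x)$ is piecewise constant and changes only at times $t$ with $(x,t)\in\xi$, at which $h_t(x)=\max\{h_{t^-}(x-1),h_{t^-}(x),h_{t^-}(x+1)\}+\eta(x,t)$ if $\varepsilon(x,t)=1$, and $h_t(x)=h_{t^-}(x)+\eta(x,t)$ if $\varepsilon(x,t)=0$. *)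

theory Defs
  imports "HOL-Probability.Probability" "HOL-Library.Extended_Nat"
begin

section \<open>Poisson processes\<close>

text \<open>Number of points of a configuration \<open>P\<close> in \<open>A\<close>, with value \<open>\<infinity>\<close> for infinitely many points
  (whereas \<open>card\<close> would give \<open>0\<close>).\<close>

definition num_points :: "'a set \<Rightarrow> 'a set \<Rightarrow> enat" where
  "num_points P A = (if finite (P \<inter> A) then enat (card (P \<inter> A)) else \<infinity>)"

text \<open>Configurations of points in \<open>space L\<close>, with the \<open>\<sigma>\<close>-algebra generated by the counting maps
  \<open>P \<mapsto> num_points P A\<close> for measurable \<open>A\<close>.\<close>

definition config_space :: "'a measure \<Rightarrow> 'a set measure" where
  "config_space L = sigma (Pow (space L))
     {{P \<in> Pow (space L). num_points P A = k} | A k. A \<in> sets L}"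

text \<open>The library's \<open>poisson_pmf\<close> is only specified for finite positive rates; the degenerate
  rates \<open>0\<close> and \<open>\<infinity>\<close> follow the usual convention.\<close>

definition poisson_enat :: "ennreal \<Rightarrow> enat pmf" where
  "poisson_enat r =
     (if r = 0 then return_pmf 0
      else if r = \<infinity> then return_pmf \<infinity>
      else map_pmf enat (poisson_pmf (enn2real r)))"

text \<open>The process is represented by its random set of points, so it is simple. This loses
  nothing for the diffuse intensity used below, whose Poisson process is almost surely simple.\<close>

locale poisson_process = prob_space M
  for M :: "'w measure" +
  fixes L :: "'a measure" and X :: "'w \<Rightarrow> 'a set"
  assumes point_process: "X \<in> measurable M (config_space L)"
    and poisson_counts: "\<And>A. A \<in> sets L \<Longrightarrow>
      distr M (count_space UNIV) (\<lambda>\<omega>. num_points (X \<omega>) A) = measure_pmf (poisson_enat (emeasure L A))"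
    and independent_counts: "\<And>A :: nat \<Rightarrow> 'a set. range A \<subseteq> sets L \<Longrightarrow> disjoint_family A \<Longrightarrow>
      indep_vars (\<lambda>_. count_space UNIV) (\<lambda>i \<omega>. num_points (X \<omega>) (A i)) UNIV"


section \<open>Bernoulli ballistic deposition\<close>

definition site_time :: "(int \<times> real) measure" where
  "site_time = count_space UNIV \<Otimes>\<^sub>M restrict_space lborel {0..}"

text \<open>Time of the \<open>n\<close>-th point (counting from \<open>0\<close>) above site \<open>x\<close>. For the process considered here
  each column \<open>{x} \<times> [0,\<infinity>)\<close> almost surely contains infinitely many points and is locally finite,
  so that these times are well defined and enumerate all points of the column.\<close>

definition arrival :: "(int \<times> real) set \<Rightarrow> int \<Rightarrow> nat \<Rightarrow> real" where
  "arrival P x n = (THE t. (x, t) \<in> P \<and> card {s. (x, s) \<in> P \<and> s < t} = n)"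

text \<open>Deterministic evolution of the heights \<open>h t x\<close> given the points \<open>P\<close> and their marks.
  For a locally finite \<open>P\<close>, the second clause says that \<open>t \<mapsto> h t x\<close> is piecewise constant,
  right-continuous and changes only at times of points above \<open>x\<close>; hence the left limits, taken
  with respect to the discrete topology of \<open>nat\<close>, exist.\<close>

definition left_height :: "(real \<Rightarrow> int \<Rightarrow> nat) \<Rightarrow> real \<Rightarrow> int \<Rightarrow> nat" where
  "left_height h t x = Lim (at_left t) (\<lambda>s. h s x)"

definition bd_evolution ::
  "(int \<times> real) set \<Rightarrow> (int \<times> real \<Rightarrow> bool) \<Rightarrow> (int \<times> real \<Rightarrow> bool) \<Rightarrow> (real \<Rightarrow> int \<Rightarrow> nat) \<Rightarrow> bool" where
  "bd_evolution P e b h \<longleftrightarrow>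
     (\<forall>x. h 0 x = 0) \<and>
     (\<forall>x s t. 0 \<le> s \<and> s \<le> t \<and> (\<forall>u\<in>{s<..t}. (x, u) \<notin> P) \<longrightarrow> h t x = h s x) \<and>
     (\<forall>x t. 0 < t \<and> (x, t) \<in> P \<longrightarrow>
        h t x =
          (if e (x, t)
           then Max {left_height h t (x - 1), left_height h t x, left_height h t (x + 1)}
           else left_height h t x) + of_bool (b (x, t)))"

text \<open>The marks are only meaningful at the points of \<open>\<xi>\<close>. That every point carries an independent
  mark means: enumerating the points column by column through \<^const>\<open>arrival\<close>, a measurable
  function of \<open>\<xi>\<close>, the marks form an i.i.d. family that is independent of \<open>\<xi>\<close>.

  The heights are a process satisfying the evolution rules almost surely (outside a null set the
  rules determine them uniquely).\<close>

locale bernoulli_ballistic_deposition = poisson_process M site_time \<xi>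
  for M :: "'w measure" and \<xi> :: "'w \<Rightarrow> (int \<times> real) set" +
  fixes p \<sigma> :: real
    and \<epsilon> \<eta> :: "'w \<Rightarrow> int \<times> real \<Rightarrow> bool"
    and h :: "'w \<Rightarrow> real \<Rightarrow> int \<Rightarrow> nat"
  assumes p: "0 < p" "p \<le> 1"
    and \<sigma>: "0 < \<sigma>" "\<sigma> \<le> 1"
    and mark_distr: "\<And>x n.
      distr M (count_space UNIV)
        (\<lambda>\<omega>. (\<epsilon> \<omega> (x, arrival (\<xi> \<omega>) x n), \<eta> \<omega> (x, arrival (\<xi> \<omega>) x n)))
      = measure_pmf (pair_pmf (bernoulli_pmf p) (bernoulli_pmf \<sigma>))"
    and marks_indep:
      "indep_vars (\<lambda>_. count_space UNIV)
        (\<lambda>(x, n) \<omega>. (\<epsilon> \<omega> (x, arrival (\<xi> \<omega>) x n), \<eta> \<omega> (x, arrival (\<xi> \<omega>) x n)))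
        (UNIV :: (int \<times> nat) set)"
    and marks_indep_points:
      "indep_set
        (sets (vimage_algebra (space M) \<xi> (config_space site_time)))
        (sets (vimage_algebra (space M)
          (\<lambda>\<omega> (x, n). (\<epsilon> \<omega> (x, arrival (\<xi> \<omega>) x n), \<eta> \<omega> (x, arrival (\<xi> \<omega>) x n)))
          (Pi\<^sub>M (UNIV :: (int \<times> nat) set) (\<lambda>_. count_space UNIV))))"
    and heights_measurable: "\<And>t x. 0 \<le> t \<Longrightarrow> (\<lambda>\<omega>. h \<omega> t x) \<in> measurable M (count_space UNIV)"
    and evolution: "AE \<omega> in M. bd_evolution (\<xi> \<omega>) (\<epsilon> \<omega>) (\<eta> \<omega>) (h \<omega>)"

end

theory Submission
  imports Defs
begin

text \<open>Run backward in time, the height \<open>h\<^sub>T(0)\<close> is a last passage value: if it is at least \<open>k\<close>, then some path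
starts at \<open>(0, T)\<close>, goes back in time, moves to a neighbouring column only at points with
\<open>\<epsilon> = 1\<close>, and meets \<open>k\<close> points with \<open>\<eta> = 1\<close>. Let \<open>m\<close> be the number of moves of this path before its
last block, and fix a threshold \<open>J\<close>. Two union bounds suffice.

If \<open>m > J\<close>, the path alone is expensive: the expected number of paths with \<open>m\<close> moves that end at a
block is at most \<open>\<sigma> T (2 p T)\<^sup>m / m!\<close>, which is tiny once \<open>J\<close> is a large multiple of \<open>p T\<close>.

If \<open>m \<le> J\<close>, forget the moves and retain only the \<open>k\<close> blocks, whose successive horizontal displacements
have total length at most \<open>J\<close>. The expected number of such chains is at most
\<open>(2 \<sigma> T)\<^sup>k / k!\<close> times the binomial coefficient of \<open>J + k\<close> over \<open>k\<close>. Not counting the moves here is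
essential: the number of paths grows exponentially in \<open>p T\<close>, the number of chains does not.

With \<open>J\<close> equal to \<open>k\<close> plus a multiple of \<open>p T\<close>, the sum of the two bounds decays geometrically as soon
as \<open>k\<close> is a large multiple of \<open>\<sigma> T + \<surd>(\<sigma> p) T\<close>, and it is of order
\<open>\<sigma> p T\<^sup>2\<close> in total if \<open>\<sigma> p T\<^sup>2 \<le> 1\<close>. Put \<open>\<gamma> = 1 / (2 - \<zeta>)\<close> and \<open>W = (\<sigma> p T\<^sup>2) powr \<gamma>\<close>. Since \<open>\<gamma>\<close> lies between
\<open>1/2\<close> and \<open>1\<close>, \<open>W\<close> dominates \<open>\<surd>(\<sigma> p) T\<close> if \<open>\<sigma> p T\<^sup>2 \<ge> 1\<close> and \<open>\<sigma> p T\<^sup>2\<close> otherwise, and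
\<open>p \<ge> T powr (- \<zeta>)\<close> gives \<open>\<sigma> T \<le> (\<sigma> powr \<gamma>) T \<le> W\<close>.

To make the paths finite objects, time is cut into \<open>N\<close> slots of length \<open>T / N\<close> and space into the
columns between \<open>-R\<close> and \<open>R\<close>. Except with a probability that vanishes as first \<open>N\<close> and then \<open>R\<close> tends to
infinity, every slot contains at most one point of this box, and some column on either
side of \<open>0\<close> within the box has no point at all. Such a column keeps height \<open>0\<close>, so nothing outside
influences \<open>h\<^sub>T(0)\<close>, and the heights at the grid times obey a discrete recursion
(\<open>evolution_imp_paths\<close>). The two expected numbers then become finite sums of weights of sets of
required marks (\<open>sum_weight_jump_paths\<close>, \<open>sum_weight_block_chains\<close>), because a set of required marks in
distinct cells has probability at most the product of their individual rates (\<open>prob_all_occur\<close>).\<close>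

section \<open>Backward paths in a discrete-time deposition model\<close>

text \<open>A cell \<open>(x, j)\<close> stands for column \<open>x\<close> during the time slot \<open>j\<close>. A pair of a cell and a mark is a
requirement: the cell has to contain a point carrying that mark. Paths are represented by the sets of
requirements that make them available.\<close>

datatype mark = Sticky | Block

type_synonym cell = "int \<times> nat"

text \<open>\<open>jump_paths j x m\<close> describes the backward paths that start in column \<open>x\<close> at the beginning of slot \<open>j\<close>, move \<open>m\<close> times
to a neighbouring column, each time at a sticky point, and then meet one block.\<close>

fun jump_paths :: "nat \<Rightarrow> int \<Rightarrow> nat \<Rightarrow> (cell \<times> mark) set set" where
  "jump_paths 0 x m = {}"
| "jump_paths (Suc j) x 0 = insert {((x, j), Block)} (jump_paths j x 0)"
| "jump_paths (Suc j) x (Suc m) = jump_paths j x (Suc m) \<union>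
     insert ((x, j), Sticky) ` (jump_paths j (x - 1) m \<union> jump_paths j (x + 1) m)"

text \<open>\<open>block_chains k j x J\<close> describes sequences of \<open>k\<close> blocks in ever earlier slots before \<open>j\<close> whose displacements,
the first one measured from \<open>x\<close>, have total length at most \<open>J\<close>. Nothing is required of the points
between the blocks.\<close>

fun block_chains :: "nat \<Rightarrow> nat \<Rightarrow> int \<Rightarrow> nat \<Rightarrow> (cell \<times> mark) set set" where
  "block_chains 0 j x J = {{}}"
| "block_chains (Suc k) j x J =
     (\<Union>i<j. \<Union>d\<in>{- int J..int J}. insert ((x + d, i), Block) ` block_chains k i (x + d) (J - nat \<bar>d\<bar>))"

lemma block_chainsI:
  assumes "i < j" "\<bar>d\<bar> \<le> int J" "S \<in> block_chains k i (x + d) (J - nat \<bar>d\<bar>)"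
  shows "insert ((x + d, i), Block) S \<in> block_chains (Suc k) j x J"
  unfolding block_chains.simps using assms by (intro UN_I[of i] UN_I[of d] imageI) auto

lemma block_chains_mono:
  "i \<le> j \<Longrightarrow> I \<le> J \<Longrightarrow> block_chains k i x I \<subseteq> block_chains k j x J"
proof (induction k arbitrary: i j I J x)
  case (Suc k)
  show ?case
  proof
    fix S assume "S \<in> block_chains (Suc k) i x I"
    then obtain l d S' where *: "l < i" "- int I \<le> d" "d \<le> int I"
      "S' \<in> block_chains k l (x + d) (I - nat \<bar>d\<bar>)" "S = insert ((x + d, l), Block) S'"
      by auto
    have "S' \<in> block_chains k l (x + d) (J - nat \<bar>d\<bar>)"
      using Suc.IH[of l l "I - nat \<bar>d\<bar>" "J - nat \<bar>d\<bar>" "x + d"] Suc.prems *(4) by (auto simp: diff_le_mono)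
    moreover have "l < j" "\<bar>d\<bar> \<le> int J" using * Suc.prems by auto
    ultimately show "S \<in> block_chains (Suc k) j x J" using *(5) block_chainsI by blast
  qed
qed simp

text \<open>Changing the starting column to a neighbour changes the first displacement by at most one. This is how a
move of the path is charged to the displacement budget of the chain.\<close>

lemma block_chains_shift:
  assumes "S \<in> block_chains k j y m" "\<bar>y - x\<bar> \<le> 1"
  shows "S \<in> block_chains k j x (Suc m)"
proof (cases k)
  case (Suc k')
  with assms(1) obtain l d S' where *: "l < j" "- int m \<le> d" "d \<le> int m"
      "S' \<in> block_chains k' l (y + d) (m - nat \<bar>d\<bar>)" "S = insert ((y + d, l), Block) S'"
    by auto
  \<comment> \<open>The same block as before, seen from \<open>x\<close> instead of \<open>y\<close>.\<close>
  define e where "e = d + (y - x)"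
  have e: "y + d = x + e" "\<bar>e\<bar> \<le> \<bar>d\<bar> + 1" using assms(2) by (auto simp: e_def)
  have "m - nat \<bar>d\<bar> \<le> Suc m - nat \<bar>e\<bar>" using e(2) by linarith
  then have "S' \<in> block_chains k' l (x + e) (Suc m - nat \<bar>e\<bar>)"
    using *(4) block_chains_mono[of l l "m - nat \<bar>d\<bar>" "Suc m - nat \<bar>e\<bar>" k' "x + e"] e(1) by auto
  moreover have "\<bar>e\<bar> \<le> int (Suc m)" using e(2) *(2,3) by auto
  ultimately show ?thesis using block_chainsI[OF *(1), of e] *(5) Suc e(1) by metis
qed (use assms in simp)

lemma block_chains_Block:
  assumes "S \<in> block_chains k j y m"
  shows "insert ((y, j), Block) S \<in> block_chains (Suc k) (Suc j) y m"
  using block_chainsI[of j "Suc j" 0 m S k y] assms by simp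

text \<open>Unrolling the recursion for the heights backward, always towards a neighbour that attains the maximum,
gives one path that is read in two ways: by its moves and last block, and by its blocks alone. Both
readings use the same number \<open>m\<close> of moves, which is what allows the later case distinction on \<open>m\<close>. The columns
\<open>a\<close> and \<open>b\<close> of height \<open>0\<close> confine the path.\<close>

lemma discrete_height_imp_paths:
  fixes g :: "nat \<Rightarrow> int \<Rightarrow> nat" and occ :: "cell \<times> mark \<Rightarrow> bool"
  assumes init: "\<And>x. g 0 x = 0"
    and walls: "\<And>j. j \<le> N \<Longrightarrow> g j a = 0" "\<And>j. j \<le> N \<Longrightarrow> g j b = 0"
    and step: "\<And>j x. j < N \<Longrightarrow> a < x \<Longrightarrow> x < b \<Longrightarrow> g (Suc j) x =
      (if occ ((x, j), Sticky) then Max {g j (x - 1), g j x, g j (x + 1)} else g j x)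
        + of_bool (occ ((x, j), Block))"
  shows "j \<le> N \<Longrightarrow> a \<le> x \<Longrightarrow> x \<le> b \<Longrightarrow> 0 < k \<Longrightarrow> k \<le> g j x \<Longrightarrow>
    \<exists>m. (\<exists>S\<in>jump_paths j x m. \<forall>r\<in>S. occ r) \<and> (\<exists>S\<in>block_chains k j x m. \<forall>r\<in>S. occ r)"
proof (induction j arbitrary: x k)
  case (Suc j)
  have "a \<noteq> x" "x \<noteq> b" using walls[OF Suc.prems(1)] Suc.prems by auto
  then have ax: "a < x" "x < b" using Suc.prems by auto
  let ?B = "occ ((x, j), Block)" and ?E = "occ ((x, j), Sticky)"
  \<comment> \<open>The height that a neighbour must already have before slot \<open>j\<close>.\<close>
  define k' where "k' = k - of_bool ?B"
  obtain y where y: "k' \<le> g j y" "y = x \<or> ?E \<and> (y = x - 1 \<or> y = x + 1)"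
  proof (cases ?E)
    case True
    have "Max {g j (x - 1), g j x, g j (x + 1)} \<in> {g j (x - 1), g j x, g j (x + 1)}"
      by (rule Max_in) auto
    then obtain y where "y \<in> {x - 1, x, x + 1}" "g (Suc j) x = g j y + of_bool ?B"
      using step[of j x] Suc.prems(1) ax True by auto
    then show ?thesis using that[of y] True Suc.prems(5) by (auto simp: k'_def)
  next
    case False
    then have "g (Suc j) x = g j x + of_bool ?B" using step[of j x] Suc.prems(1) ax by simp
    then show ?thesis using that[of x] Suc.prems(5) by (auto simp: k'_def)
  qed
  show ?case
  proof (cases "k' = 0")
    case True
    then have "?B" "k = 1" using Suc.prems(4) by (auto simp: k'_def of_bool_def split: if_splits)
    moreover have "{((x, j), Block)} \<in> block_chains 1 (Suc j) x 0"
      using block_chains_Block[of "{}" 0 j x 0] by simp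
    ultimately show ?thesis by (intro exI[of _ 0]) auto
  next
    case False
    have "a \<le> y" "y \<le> b" using y(2) ax by auto
    then obtain m S S' where m: "S \<in> jump_paths j y m" "\<forall>r\<in>S. occ r" "S' \<in> block_chains k' j y m" "\<forall>r\<in>S'. occ r"
      using Suc.IH[of y k'] Suc.prems(1) False y(1) by auto
    define m' where "m' = (if y = x then m else Suc m)"
    have "\<exists>S\<in>jump_paths (Suc j) x m'. \<forall>r\<in>S. occ r"
    proof (cases "y = x")
      case True
      then have "S \<in> jump_paths (Suc j) x m'" using m(1) by (cases m) (auto simp: m'_def)
      then show ?thesis using m(2) by blast
    next
      case False
      then have "insert ((x, j), Sticky) S \<in> jump_paths (Suc j) x m'" "?E" using m(1) y(2) by (auto simp: m'_def)
      then show ?thesis using m(2) by blast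
    qed
    moreover
    have S': "S' \<in> block_chains k' j x m'"
      using m(3) block_chains_shift[of S' k' j y m x] y(2) by (auto simp: m'_def)
    have "\<exists>S\<in>block_chains k (Suc j) x m'. \<forall>r\<in>S. occ r"
    proof (cases ?B)
      case True
      then have "k = Suc k'" using Suc.prems(4) by (auto simp: k'_def)
      then have "insert ((x, j), Block) S' \<in> block_chains k (Suc j) x m'" using block_chains_Block[OF S'] by blast
      then show ?thesis using m(4) True by blast
    next
      case False
      then have "k = k'" by (auto simp: k'_def)
      then have "S' \<in> block_chains k (Suc j) x m'" using S' block_chains_mono[of j "Suc j" m' m' k x] by auto
      then show ?thesis using m(4) by blast
    qed
    ultimately show ?thesis by blast
  qed
qed (simp add: init)

section \<open>Counting weighted requirements\<close>

text \<open>Injectivity of \<^const>\<open>fst\<close> says that at most one mark is required per cell, so that the requirements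
are independent.\<close>

definition admissible :: "nat \<Rightarrow> (cell \<times> mark) set \<Rightarrow> bool" where
  "admissible j S \<longleftrightarrow> finite S \<and> inj_on fst S \<and> (\<forall>r\<in>S. snd (fst r) < j)"

lemma admissible_insert:
  assumes "admissible i S" "i < j"
  shows "admissible j (insert ((x, i), mk) S)" "((x, i), mk) \<notin> S"
proof -
  show "((x, i), mk) \<notin> S" using assms(1) by (auto simp: admissible_def)
  have "(x, i) \<notin> fst ` S" using assms(1) by (auto simp: admissible_def)
  then show "admissible j (insert ((x, i), mk) S)"
    using assms by (auto simp: admissible_def)
qed

lemma admissible_mono: "admissible i S \<Longrightarrow> i \<le> j \<Longrightarrow> admissible j S"
  by (auto simp: admissible_def)

lemma jump_paths_admissible: "S \<in> jump_paths j x m \<Longrightarrow> admissible j S"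
proof (induction j x m arbitrary: S rule: jump_paths.induct)
  case (2 j x)
  then show ?case using admissible_mono[of j S "Suc j"] by (auto simp: admissible_def)
next
  case (3 j x m)
  consider "S \<in> jump_paths j x (Suc m)"
    | S' where "S' \<in> jump_paths j (x - 1) m \<or> S' \<in> jump_paths j (x + 1) m" "S = insert ((x, j), Sticky) S'"
    using 3(4) by auto
  then show ?case
  proof cases
    case 1
    then show ?thesis using 3(1) admissible_mono le_SucI by blast
  next
    case 2
    then show ?thesis using 3(2,3) admissible_insert(1) by blast
  qed
qed simp

lemma block_chains_admissible: "S \<in> block_chains k j x J \<Longrightarrow> admissible j S"
proof (induction k arbitrary: S j x J)
  case (Suc k)
  then obtain i d S' where "i < j" "S' \<in> block_chains k i (x + d) (J - nat \<bar>d\<bar>)" "S = insert ((x + d, i), Block) S'"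
    by auto
  then show ?case using Suc.IH admissible_insert(1) by blast
qed (simp add: admissible_def)

lemma jump_paths_empty: "j \<le> m \<Longrightarrow> jump_paths j x m = {}"
  by (induction j x m rule: jump_paths.induct) auto

lemma finite_jump_paths: "finite (jump_paths j x m)"
  by (induction j x m rule: jump_paths.induct) auto

lemma finite_block_chains: "finite (block_chains k j x J)"
  by (induction k arbitrary: j x J) auto

definition weight :: "(mark \<Rightarrow> real) \<Rightarrow> (cell \<times> mark) set \<Rightarrow> real" where
  "weight w S = (\<Prod>r\<in>S. w (snd r))"

lemma sum_Un_le:
  fixes f :: "'a \<Rightarrow> real"
  assumes "finite A" "finite B" "\<And>x. 0 \<le> f x"
  shows "sum f (A \<union> B) \<le> sum f A + sum f B"
  using assms by (subst sum.union_inter[symmetric]) (auto intro: sum_nonneg)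

lemma sum_UN_le:
  fixes f :: "'a \<Rightarrow> real"
  assumes "finite I" "\<And>i. i \<in> I \<Longrightarrow> finite (A i)" "\<And>x. 0 \<le> f x"
  shows "sum f (\<Union>i\<in>I. A i) \<le> (\<Sum>i\<in>I. sum f (A i))"
  using assms
proof (induction I rule: finite_induct)
  case (insert i I)
  then show ?case using sum_Un_le[of "A i" "\<Union>i\<in>I. A i" f] by fastforce
qed simp

lemma weight_nonneg: "(\<And>mk. 0 \<le> w mk) \<Longrightarrow> 0 \<le> weight w S"
  by (auto simp: weight_def intro: prod_nonneg)

lemma sum_weight_insert:
  assumes w: "\<And>mk. 0 \<le> w mk" and fin: "finite \<S>" and adm: "\<And>S. S \<in> \<S> \<Longrightarrow> admissible i S"
  shows "sum (weight w) (insert ((x, i), mk) ` \<S>) \<le> w mk * sum (weight w) \<S>"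
proof -
  have "sum (weight w) (insert ((x, i), mk) ` \<S>) \<le> sum (weight w \<circ> insert ((x, i), mk)) \<S>"
    by (rule sum_image_le[OF fin]) (simp add: weight_nonneg w)
  also have "\<dots> = (\<Sum>S\<in>\<S>. w mk * weight w S)"
  proof (rule sum.cong)
    fix S assume "S \<in> \<S>"
    then have "finite S" "((x, i), mk) \<notin> S"
      using adm[of S] admissible_insert(2)[of i S "Suc i"] by (auto simp: admissible_def)
    then show "(weight w \<circ> insert ((x, i), mk)) S = w mk * weight w S"
      by (simp add: weight_def)
  qed simp
  finally show ?thesis by (simp add: sum_distrib_left)
qed

text \<open>Each slot before \<open>j\<close> is idle or hosts one of the \<open>m + 1\<close> points of the path, and a move has two directions;
the recursion for \<^const>\<open>jump_paths\<close> is Pascal's rule.\<close>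

lemma sum_weight_jump_paths:
  assumes w: "\<And>mk. 0 \<le> w mk"
  shows "sum (weight w) (jump_paths j x m) \<le> w Block * (2 * w Sticky) ^ m * real (j choose Suc m)"
proof (induction j x m rule: jump_paths.induct)
  case (2 j x)
  have "sum (weight w) (jump_paths (Suc j) x 0) \<le> sum (weight w) {{((x, j), Block)}} + sum (weight w) (jump_paths j x 0)"
    using sum_Un_le[of "{{((x, j), Block)}}" "jump_paths j x 0" "weight w"]
    by (simp add: finite_jump_paths weight_nonneg w)
  then show ?case using 2 by (simp add: weight_def algebra_simps)
next
  case (3 j x m)
  let ?b = "w Block * (2 * w Sticky) ^ m * real (j choose Suc m)"
  have "sum (weight w) (insert ((x, j), Sticky) ` (jump_paths j (x - 1) m \<union> jump_paths j (x + 1) m))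
      \<le> w Sticky * sum (weight w) (jump_paths j (x - 1) m \<union> jump_paths j (x + 1) m)"
    by (rule sum_weight_insert) (auto simp: w finite_jump_paths dest: jump_paths_admissible)
  also have "\<dots> \<le> w Sticky * (?b + ?b)"
    using 3(2,3) w[of Sticky] sum_Un_le[of "jump_paths j (x - 1) m" "jump_paths j (x + 1) m" "weight w"]
    by (intro mult_left_mono) (simp_all only: w finite_jump_paths weight_nonneg, linarith)
  finally have "sum (weight w) (jump_paths (Suc j) x (Suc m)) \<le>
      w Block * (2 * w Sticky) ^ Suc m * real (j choose Suc (Suc m)) + w Sticky * (?b + ?b)"
    using sum_Un_le[of "jump_paths j x (Suc m)" "insert ((x, j), Sticky) ` (jump_paths j (x - 1) m \<union> jump_paths j (x + 1) m)" "weight w"] 3(1)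
    by (simp add: finite_jump_paths weight_nonneg w)
  then show ?case by (simp add: algebra_simps)
qed simp

text \<open>The hockey-stick identity, counted twice for the two signs of \<open>d\<close>.\<close>

lemma sum_displacements:
  "(\<Sum>d\<in>{- int J..int J}. (J - nat \<bar>d\<bar> + k) choose k) \<le> 2 * (Suc J + k choose Suc k)"
proof -
  have eq: "{- int J..int J} = int ` {..J} \<union> (\<lambda>i. - int i) ` {..J}"
  proof (intro set_eqI iffI)
    fix d assume "d \<in> {- int J..int J}"
    then have "d = int (nat d) \<and> nat d \<le> J \<or> d = - int (nat (- d)) \<and> nat (- d) \<le> J" by auto
    then show "d \<in> int ` {..J} \<union> (\<lambda>i. - int i) ` {..J}" by blast
  qed auto
  have half: "(\<Sum>i\<le>J. (J - i + k) choose k) = Suc J + k choose Suc k"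
  proof -
    have "(\<Sum>i\<le>J. (J - i + k) choose k) = (\<Sum>i\<le>J. (i + k) choose k)"
      by (rule sum.reindex_bij_witness[of _ "\<lambda>i. J - i" "\<lambda>i. J - i"]) auto
    also have "\<dots> = Suc J + k choose Suc k"
      using choose_rising_sum(1)[of k J] by (simp add: add.commute)
    finally show ?thesis .
  qed
  let ?f = "\<lambda>d. (J - nat \<bar>d\<bar> + k) choose k"
  have "sum ?f {- int J..int J} \<le> sum ?f (int ` {..J}) + sum ?f ((\<lambda>i. - int i) ` {..J})"
    unfolding eq by (subst sum.union_inter[symmetric]) auto
  also have "\<dots> = 2 * (\<Sum>i\<le>J. (J - i + k) choose k)"
    by (subst (1 2) sum.reindex) (auto simp: inj_on_def)
  finally show ?thesis using half by simp
qed

text \<open>Choose the \<open>k\<close> slots, the \<open>k\<close> signs of the displacements, and their \<open>k\<close> absolute values with sum at most \<open>J\<close>.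
The induction on \<open>k\<close> sums binomial coefficients over the latest slot and over the first displacement.\<close>

lemma sum_weight_block_chains:
  assumes w: "\<And>mk. 0 \<le> w mk"
  shows "sum (weight w) (block_chains k j x J) \<le> (2 * w Block) ^ k * real (j choose k) * real (J + k choose k)"
proof (induction k arbitrary: j x J)
  case (Suc k)
  let ?D = "{- int J..int J}"
  let ?c = "\<lambda>i d. block_chains k i (x + d) (J - nat \<bar>d\<bar>)"
  have "sum (weight w) (block_chains (Suc k) j x J)
      \<le> (\<Sum>i<j. sum (weight w) (\<Union>d\<in>?D. insert ((x + d, i), Block) ` ?c i d))"
    unfolding block_chains.simps by (rule sum_UN_le) (auto simp: finite_block_chains weight_nonneg w)
  also have "\<dots> \<le> (\<Sum>i<j. \<Sum>d\<in>?D. sum (weight w) (insert ((x + d, i), Block) ` ?c i d))"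
    by (intro sum_mono sum_UN_le) (auto simp: finite_block_chains weight_nonneg w)
  also have "\<dots> \<le> (\<Sum>i<j. \<Sum>d\<in>?D. w Block *
      ((2 * w Block) ^ k * real (i choose k) * real (J - nat \<bar>d\<bar> + k choose k)))"
    by (intro sum_mono order_trans[OF sum_weight_insert] mult_left_mono Suc.IH)
      (auto simp: w finite_block_chains intro: block_chains_admissible)
  also have "\<dots> = w Block * (2 * w Block) ^ k * real (\<Sum>i<j. i choose k) *
      real (\<Sum>d\<in>?D. J - nat \<bar>d\<bar> + k choose k)"
    by (simp add: sum_distrib_left sum_distrib_right algebra_simps)
  also have "\<dots> \<le> w Block * (2 * w Block) ^ k * real (j choose Suc k) * real (2 * (Suc J + k choose Suc k))"
  proof (intro mult_mono of_nat_mono sum_displacements)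
    have "(\<Sum>i<j. i choose k) = j choose Suc k"
      by (induction j) auto
    then show "(\<Sum>i<j. i choose k) \<le> j choose Suc k" by simp
  qed (auto simp: w simp del: of_nat_sum)
  finally show ?case by (simp add: algebra_simps)
qed (simp add: weight_def)

section \<open>Reading the discrete model off a point configuration\<close>

definition cell_set :: "real \<Rightarrow> cell \<Rightarrow> (int \<times> real) set" where
  "cell_set d c = {fst c} \<times> {real (snd c) * d<..real (Suc (snd c)) * d}"

definition before_set :: "real \<Rightarrow> cell \<Rightarrow> (int \<times> real) set" where
  "before_set d c = {fst c} \<times> {0..real (snd c) * d}"

primrec mark_at :: "(int \<times> real \<Rightarrow> bool) \<Rightarrow> (int \<times> real \<Rightarrow> bool) \<Rightarrow> mark \<Rightarrow> int \<times> real \<Rightarrow> bool" where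
  "mark_at e b Sticky = e"
| "mark_at e b Block = b"

text \<open>Marks are attached to the points of a column in the order of arrival. The single point of a cell is
therefore identified by the number \<open>n\<close> of points of the column up to the start of the slot, a quantity
that depends on the points only. The formulation through \<open>n\<close> is what makes the independence of marks and
points applicable.\<close>

definition occurs ::
  "real \<Rightarrow> (int \<times> real) set \<Rightarrow> (int \<times> real \<Rightarrow> bool) \<Rightarrow> (int \<times> real \<Rightarrow> bool) \<Rightarrow> cell \<times> mark \<Rightarrow> bool" where
  "occurs d P e b r \<longleftrightarrow> (\<exists>n. num_points P (before_set d (fst r)) = enat n \<and>
     num_points P (cell_set d (fst r)) = 1 \<and>
     mark_at e b (snd r) (fst (fst r), arrival P (fst (fst r)) n))"

lemma num_points_mono: "A \<subseteq> B \<Longrightarrow> num_points P A \<le> num_points P B"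
  unfolding num_points_def
  by (auto intro!: card_mono dest: finite_subset[of "P \<inter> A" "P \<inter> B", rotated])

lemma num_points_le_1_unique:
  assumes "num_points P A \<le> 1" "y \<in> P" "y \<in> A" "z \<in> P" "z \<in> A"
  shows "y = z"
proof -
  have fin: "finite (P \<inter> A)" using assms(1) by (auto simp: num_points_def split: if_splits)
  then have "card (P \<inter> A) \<le> Suc 0" using assms(1) by (auto simp: num_points_def one_enat_def)
  with fin show "y = z" using assms(2-) card_le_Suc0_iff_eq by blast
qed

text \<open>Finiteness is needed at all times, not just up to \<open>t\<close>: \<^const>\<open>card\<close> is \<open>0\<close> on infinite sets, so a
column with an accumulation point could have several points of index \<open>0\<close>.\<close>

lemma arrival_eq:
  assumes fin: "\<And>t. finite {s. (x, s) \<in> P \<and> s < t}" and "(x, t) \<in> P"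
  shows "arrival P x (card {s. (x, s) \<in> P \<and> s < t}) = t"
  unfolding arrival_def
proof (rule the_equality)
  have less: "card {s. (x, s) \<in> P \<and> s < u} < card {s. (x, s) \<in> P \<and> s < v}"
    if "(x, u) \<in> P" "u < v" for u v
    by (rule psubset_card_mono[OF fin]) (use that in auto)
  show "u = t" if "(x, u) \<in> P \<and> card {s. (x, s) \<in> P \<and> s < u} = card {s. (x, s) \<in> P \<and> s < t}" for u
    using less[of u t] less[of t u] that assms(2) by (cases u t rule: linorder_cases) auto
qed (use assms in simp)

lemma evolution_const:
  assumes ev: "bd_evolution P e b h"
    and "0 \<le> s" "s \<le> t" "\<And>u. s < u \<Longrightarrow> u \<le> t \<Longrightarrow> (x, u) \<notin> P"
  shows "h t x = h s x"
proof -
  have "\<forall>x s t. 0 \<le> s \<and> s \<le> t \<and> (\<forall>u\<in>{s<..t}. (x, u) \<notin> P) \<longrightarrow> h t x = h s x"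
    using ev unfolding bd_evolution_def by (elim conjE)
  from this[rule_format, of s t x] show ?thesis using assms(2-) by simp
qed

lemma left_height_eq:
  assumes ev: "bd_evolution P e b h" and "0 \<le> s" "s < t" "\<And>u. s < u \<Longrightarrow> u < t \<Longrightarrow> (y, u) \<notin> P"
  shows "left_height h t y = h s y"
proof -
  have "h u y = h s y" if "s < u" "u < t" for u
    by (rule evolution_const[OF ev]) (use assms(2-) that in auto)
  then have "eventually (\<lambda>u. h u y = h s y) (at_left t)"
    using assms(3) eventually_at_left by blast
  then show ?thesis
    unfolding left_height_def by (intro tendsto_Lim tendsto_eventually) auto
qed

text \<open>If the three columns around \<open>x\<close> have at most one point in a slot, then at the time of a point above \<open>x\<close> the
left limits still equal the heights at the start of the slot, and the evolution rule
becomes one step of the discrete recursion.\<close>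

lemma evolution_slot:
  assumes ev: "bd_evolution P e b h"
    and fin: "\<And>x t. finite {s. (x, s) \<in> P \<and> s < t}" and nonneg: "\<And>x s. (x, s) \<in> P \<Longrightarrow> 0 \<le> s"
    and d: "0 < d"
    and slot: "num_points P ({x - 1..x + 1} \<times> {real j * d<..real (Suc j) * d}) \<le> 1"
  shows "h (real (Suc j) * d) x =
    (if occurs d P e b ((x, j), Sticky)
     then Max {h (real j * d) (x - 1), h (real j * d) x, h (real j * d) (x + 1)} else h (real j * d) x)
      + of_bool (occurs d P e b ((x, j), Block))"
proof -
  define g where "g j = h (real j * d)" for j
  let ?s = "real j * d" and ?t = "real (Suc j) * d"
  have st: "0 \<le> ?s" "?s < ?t" using d by auto
  have uniq: "y = x' \<and> u = v" if "(y, u) \<in> P" "(x', v) \<in> P" "?s < u" "u \<le> ?t" "?s < v" "v \<le> ?t"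
    "x - 1 \<le> y" "y \<le> x + 1" "x - 1 \<le> x'" "x' \<le> x + 1" for y u x' v
    using num_points_le_1_unique[OF slot, of "(y, u)" "(x', v)"] that by auto
  have "g (Suc j) x =
    (if occurs d P e b ((x, j), Sticky) then Max {g j (x - 1), g j x, g j (x + 1)} else g j x)
      + of_bool (occurs d P e b ((x, j), Block))"
  proof (cases "\<exists>u. (x, u) \<in> P \<and> ?s < u \<and> u \<le> ?t")
    case False
    then have "P \<inter> cell_set d (x, j) = {}" by (auto simp: cell_set_def)
    then have "\<not> occurs d P e b ((x, j), mk)" for mk
      by (simp add: occurs_def num_points_def zero_enat_def[symmetric])
    moreover have "g (Suc j) x = g j x" unfolding g_def by (rule evolution_const[OF ev]) (use False st in auto)
    ultimately show ?thesis by simp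
  next
    case True
    then obtain u where u: "(x, u) \<in> P" "?s < u" "u \<le> ?t" by auto
    have left: "left_height h u y = g j y" if "x - 1 \<le> y" "y \<le> x + 1" for y
      unfolding g_def
    proof (rule left_height_eq[OF ev])
      show "(y, w) \<notin> P" if "?s < w" "w < u" for w
        using uniq[of y w x u] u \<open>x - 1 \<le> y\<close> \<open>y \<le> x + 1\<close> that by auto
    qed (use u st in auto)
    have occ: "occurs d P e b ((x, j), mk) \<longleftrightarrow> mark_at e b mk (x, u)" for mk
    proof -
      have "P \<inter> cell_set d (x, j) = {(x, u)}"
      proof (intro set_eqI iffI)
        fix z assume z: "z \<in> P \<inter> cell_set d (x, j)"
        then obtain s where s: "z = (x, s)" "?s < s" "s \<le> ?t" by (auto simp: cell_set_def)
        with z u have "s = u" using uniq[of x s x u] by auto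
        then show "z \<in> {(x, u)}" using s by simp
      qed (use u in \<open>auto simp: cell_set_def\<close>)
      moreover have before: "P \<inter> before_set d (x, j) = Pair x ` {s. (x, s) \<in> P \<and> s < u}"
      proof (intro set_eqI iffI)
        fix z assume z: "z \<in> P \<inter> before_set d (x, j)"
        then obtain s where "z = (x, s)" "s \<le> ?s" by (auto simp: before_set_def)
        with z u(2) show "z \<in> Pair x ` {s. (x, s) \<in> P \<and> s < u}" by auto
      next
        fix z assume "z \<in> Pair x ` {s. (x, s) \<in> P \<and> s < u}"
        then obtain s where s: "z = (x, s)" "(x, s) \<in> P" "s < u" by blast
        then have "s \<le> ?s" using u uniq[of x s x u] by force
        then show "z \<in> P \<inter> before_set d (x, j)" using s nonneg by (auto simp: before_set_def)
      qed
      have "finite (P \<inter> before_set d (x, j))" "card (P \<inter> before_set d (x, j)) = card {s. (x, s) \<in> P \<and> s < u}"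
        unfolding before using fin by (auto intro!: card_image simp: inj_on_def)
      ultimately have cnt: "num_points P (cell_set d (x, j)) = 1"
        "num_points P (before_set d (x, j)) = enat (card {s. (x, s) \<in> P \<and> s < u})"
        by (simp_all add: num_points_def one_enat_def)
      show ?thesis
        unfolding occurs_def fst_conv snd_conv cnt by (simp add: arrival_eq[OF fin u(1)])
    qed
    have "0 < u" using u(2) st by linarith
    have "g (Suc j) x = h u x"
      unfolding g_def
    proof (rule evolution_const[OF ev])
      show "(x, w) \<notin> P" if "u < w" "w \<le> ?t" for w
        using uniq[of x w x u] u that by auto
    qed (use u \<open>0 < u\<close> in auto)
    also have "\<dots> = (if e (x, u) then Max {left_height h u (x - 1), left_height h u x, left_height h u (x + 1)}
           else left_height h u x) + of_bool (b (x, u))"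
      using ev u(1) \<open>0 < u\<close> unfolding bd_evolution_def by blast
    finally show ?thesis by (simp add: left occ)
  qed
  then show ?thesis by (simp only: g_def)
qed

lemma evolution_imp_paths:
  assumes ev: "bd_evolution P e b h"
    and fin: "\<And>x t. finite {s. (x, s) \<in> P \<and> s < t}" and nonneg: "\<And>x s. (x, s) \<in> P \<Longrightarrow> 0 \<le> s"
    and d: "0 < d"
    and slots: "\<And>j. j < N \<Longrightarrow> num_points P ({- R..R} \<times> {real j * d<..real (Suc j) * d}) \<le> 1"
    and l: "- R \<le> l" "l < 0" "\<And>u. 0 < u \<Longrightarrow> u \<le> real N * d \<Longrightarrow> (l, u) \<notin> P"
    and r: "0 < r" "r \<le> R" "\<And>u. 0 < u \<Longrightarrow> u \<le> real N * d \<Longrightarrow> (r, u) \<notin> P"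
    and k: "0 < k" "k \<le> h (real N * d) 0"
  shows "\<exists>m. (\<exists>S\<in>jump_paths N 0 m. \<forall>r\<in>S. occurs d P e b r) \<and>
             (\<exists>S\<in>block_chains k N 0 m. \<forall>r\<in>S. occurs d P e b r)"
proof -
  have init: "h 0 x = 0" for x using ev by (auto simp: bd_evolution_def)
  have wall: "h (real j * d) x = 0" if "\<And>u. 0 < u \<Longrightarrow> u \<le> real N * d \<Longrightarrow> (x, u) \<notin> P" "j \<le> N" for j x
  proof -
    have "real j * d \<le> real N * d" using that(2) d by simp
    then have "(x, u) \<notin> P" if "0 < u" "u \<le> real j * d" for u
      using \<open>\<And>u. 0 < u \<Longrightarrow> u \<le> real N * d \<Longrightarrow> (x, u) \<notin> P\<close>[of u] that by auto
    then have "h (real j * d) x = h 0 x"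
      using d by (intro evolution_const[OF ev]) auto
    then show ?thesis by (simp add: init)
  qed
  show ?thesis
  proof (rule discrete_height_imp_paths[where N = N and a = l and b = r and g = "\<lambda>j. h (real j * d)"])
    fix j x assume "j < N" "l < x" "x < r"
    then have "num_points P ({x - 1..x + 1} \<times> {real j * d<..real (Suc j) * d}) \<le> 1"
      using l r by (intro order_trans[OF num_points_mono slots[of j]] Sigma_mono) auto
    with ev fin nonneg d show "h (real (Suc j) * d) x = (if occurs d P e b ((x, j), Sticky)
        then Max {h (real j * d) (x - 1), h (real j * d) x, h (real j * d) (x + 1)} else h (real j * d) x)
        + of_bool (occurs d P e b ((x, j), Block))"
      by (rule evolution_slot)
  qed (use init wall[OF l(3)] wall[OF r(3)] l r k in auto)
qed

section \<open>Counts of a Poisson process\<close>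

context poisson_process
begin

lemma count_measurable [measurable]:
  assumes "A \<in> sets L"
  shows "(\<lambda>\<omega>. num_points (X \<omega>) A) \<in> measurable M (count_space UNIV)"
proof -
  have "indep_vars (\<lambda>_. count_space UNIV)
      (\<lambda>i \<omega>. num_points (X \<omega>) (if i = 0 then A else {})) (UNIV :: nat set)"
    using assms by (intro independent_counts) (auto simp: disjoint_family_on_def)
  then have "(\<lambda>\<omega>. num_points (X \<omega>) (if (0 :: nat) = 0 then A else {})) \<in> measurable M (count_space UNIV)"
    unfolding indep_vars_def by blast
  then show ?thesis by simp
qed

lemma count_event:
  assumes "A \<in> sets L"
  shows "{\<omega> \<in> space M. Q (num_points (X \<omega>) A)} \<in> events"
  using measurable_sets[OF count_measurable[OF assms], of "{k. Q k}"]
  by (simp add: vimage_def Int_def conj_commute)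

lemma count_event_vimage:
  assumes "A \<in> sets L"
  shows "{\<omega> \<in> space M. num_points (X \<omega>) A = k} \<in> sets (vimage_algebra (space M) X (config_space L))"
proof -
  let ?C = "{P \<in> Pow (space L). num_points P A = k}"
  have "?C \<in> sets (config_space L)"
    unfolding config_space_def using assms by (subst sets_measure_of) auto
  then have "X -` ?C \<inter> space M \<in> sets (vimage_algebra (space M) X (config_space L))"
    by (rule in_vimage_algebra)
  moreover have "X \<omega> \<in> Pow (space L)" if "\<omega> \<in> space M" for \<omega>
    using measurable_space[OF point_process that] by (simp add: config_space_def space_measure_of_conv)
  then have "X -` ?C \<inter> space M = {\<omega> \<in> space M. num_points (X \<omega>) A = k}" by auto
  ultimately show ?thesis by simp
qed

lemma prob_count:
  assumes "A \<in> sets L"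
  shows "prob {\<omega> \<in> space M. num_points (X \<omega>) A \<in> K} = measure_pmf.prob (poisson_enat (emeasure L A)) K"
proof -
  have "measure (distr M (count_space UNIV) (\<lambda>\<omega>. num_points (X \<omega>) A)) K
      = prob ((\<lambda>\<omega>. num_points (X \<omega>) A) -` K \<inter> space M)"
    using count_measurable[OF assms] by (subst measure_distr) auto
  then show ?thesis
    unfolding poisson_counts[OF assms] by (simp add: vimage_def Int_def conj_commute)
qed

text \<open>The independence of counts over sequences of disjoint sets, carried over to arbitrary finite index sets by
padding an enumeration with empty sets.\<close>

lemma prob_counts_indep:
  assumes I: "finite I" and A: "\<And>i. i \<in> I \<Longrightarrow> A i \<in> sets L" "disjoint_family_on A I"
  shows "prob {\<omega> \<in> space M. \<forall>i\<in>I. num_points (X \<omega>) (A i) \<in> K i}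
    = (\<Prod>i\<in>I. prob {\<omega> \<in> space M. num_points (X \<omega>) (A i) \<in> K i})"
proof (cases "I = {}")
  case False
  obtain f where f: "bij_betw f {0..<card I} I" using ex_bij_betw_nat_finite[OF I] by blast
  define B where "B n = (if n < card I then A (f n) else {})" for n
  have fI: "f n \<in> I" if "n < card I" for n using f that by (auto simp: bij_betw_def)
  have "disjoint_family B"
  proof (unfold disjoint_family_on_def, intro ballI impI)
    fix m n :: nat assume "m \<noteq> n"
    have "f m \<noteq> f n" if "m < card I" "n < card I"
      using f \<open>m \<noteq> n\<close> that by (auto simp: bij_betw_def inj_on_def)
    then show "B m \<inter> B n = {}"
      using A(2) fI[of m] fI[of n] by (auto simp: B_def disjoint_family_on_def)
  qed
  moreover have "range B \<subseteq> sets L" using A(1) fI by (auto simp: B_def)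
  ultimately have ind: "indep_vars (\<lambda>_. count_space UNIV) (\<lambda>i \<omega>. num_points (X \<omega>) (B i)) UNIV"
    by (intro independent_counts)
  let ?E = "\<lambda>i. {\<omega> \<in> space M. num_points (X \<omega>) (A i) \<in> K i}"
  have E: "(\<lambda>\<omega>. num_points (X \<omega>) (B n)) -` K (f n) \<inter> space M = ?E (f n)" if "n \<in> {0..<card I}" for n
    using that by (auto simp: B_def)
  have "prob (\<Inter>n\<in>{0..<card I}. (\<lambda>\<omega>. num_points (X \<omega>) (B n)) -` K (f n) \<inter> space M)
      = (\<Prod>n\<in>{0..<card I}. prob ((\<lambda>\<omega>. num_points (X \<omega>) (B n)) -` K (f n) \<inter> space M))"
    using False I by (intro indep_varsD[OF ind]) (auto simp: card_gt_0_iff)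
  also have "(\<Inter>n\<in>{0..<card I}. (\<lambda>\<omega>. num_points (X \<omega>) (B n)) -` K (f n) \<inter> space M)
      = (\<Inter>n\<in>{0..<card I}. ?E (f n))"
    by (rule INF_cong[OF refl E])
  also have "\<dots> = (\<Inter>i\<in>f ` {0..<card I}. ?E i)" by (simp only: image_image)
  also have "f ` {0..<card I} = I" using f by (simp add: bij_betw_def)
  also have "(\<Prod>n\<in>{0..<card I}. prob ((\<lambda>\<omega>. num_points (X \<omega>) (B n)) -` K (f n) \<inter> space M))
      = (\<Prod>n\<in>{0..<card I}. prob (?E (f n)))"
    by (rule prod.cong[OF refl]) (simp only: E)
  also have "(\<Inter>i\<in>I. ?E i) = {\<omega> \<in> space M. \<forall>i\<in>I. num_points (X \<omega>) (A i) \<in> K i}"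
    using False by auto
  also have "(\<Prod>n\<in>{0..<card I}. prob (?E (f n))) = (\<Prod>i\<in>I. prob (?E i))"
    by (rule prod.reindex_bij_betw[OF f])
  finally show ?thesis .
qed (simp add: prob_space)

context
  fixes A :: "'a set" and r :: real
  assumes A: "A \<in> sets L" and r: "0 < r" "emeasure L A = ennreal r"
begin

lemma poisson_enat_A: "poisson_enat (emeasure L A) = map_pmf enat (poisson_pmf r)"
  using r by (simp add: poisson_enat_def)

lemma AE_finite_points: "AE \<omega> in M. finite (X \<omega> \<inter> A)"
proof -
  have "prob {\<omega> \<in> space M. num_points (X \<omega>) A \<in> range enat} = 1"
    unfolding prob_count[OF A] poisson_enat_A by (simp add: vimage_def)
  then have "AE \<omega> in M. num_points (X \<omega>) A \<in> range enat"
    using prob_Collect_eq_1[of "\<lambda>\<omega>. num_points (X \<omega>) A \<in> range enat"] count_measurable[OF A] by simp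
  then show ?thesis by eventually_elim (auto simp: num_points_def split: if_splits)
qed

lemma prob_enat:
  "prob {\<omega> \<in> space M. num_points (X \<omega>) A = enat n} = r ^ n / fact n * exp (- r)"
proof -
  have "pmf (map_pmf enat (poisson_pmf r)) (enat n) = pmf (poisson_pmf r) n"
    by (rule pmf_map_inj') (simp add: inj_def)
  then show ?thesis
    using prob_count[OF A, of "{enat n}"] r(1)
    unfolding poisson_enat_A by (simp add: measure_pmf_single)
qed

lemma prob_no_point: "prob {\<omega> \<in> space M. num_points (X \<omega>) A = 0} = exp (- r)"
  using prob_enat[of 0] by (simp add: zero_enat_def)

lemma prob_one_point_le: "prob {\<omega> \<in> space M. num_points (X \<omega>) A = 1} \<le> r"
  using prob_enat[of 1] r by (simp add: one_enat_def mult_left_le)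

lemma prob_two_points_le: "prob {\<omega> \<in> space M. \<not> num_points (X \<omega>) A \<le> 1} \<le> r\<^sup>2"
proof -
  note count_measurable[OF A, measurable]
  have one: "prob {\<omega> \<in> space M. num_points (X \<omega>) A = 1} = r * exp (- r)"
    using prob_enat[of 1] by (simp add: one_enat_def)
  have "{\<omega> \<in> space M. num_points (X \<omega>) A \<le> 1}
      = {\<omega> \<in> space M. num_points (X \<omega>) A = 0} \<union> {\<omega> \<in> space M. num_points (X \<omega>) A = 1}"
    by (auto simp: le_less enat_0_iff zero_enat_def one_enat_def elim!: less_enatE)
  also have "prob \<dots> = exp (- r) + r * exp (- r)"
    by (subst finite_measure_Union) (auto simp: one prob_no_point)
  finally have "prob {\<omega> \<in> space M. \<not> num_points (X \<omega>) A \<le> 1} = 1 - (1 + r) * exp (- r)"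
    by (subst prob_neg) (auto simp: algebra_simps)
  also have "\<dots> \<le> 1 - (1 + r) * (1 - r)"
    using exp_ge_add_one_self[of "- r"] r by (intro diff_left_mono mult_left_mono) auto
  finally show ?thesis by (simp add: algebra_simps power2_eq_square)
qed

end

end

lemma site_time_rectangle:
  assumes "finite V" "I \<in> sets borel" "I \<subseteq> {0..}"
  shows "V \<times> I \<in> sets site_time" "emeasure site_time (V \<times> I) = of_nat (card V) * emeasure lborel I"
proof -
  have half: "({0..} :: real set) \<in> sets lborel" by simp
  have I: "I \<in> sets (restrict_space lborel {0..})"
    using assms(2,3) by (subst sets_restrict_space_iff) auto
  interpret time: sigma_finite_measure "restrict_space lborel {0..} :: real measure"
    by (rule sigma_finite_measure_restrict_space[OF lborel.sigma_finite_measure_axioms half])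
  show "V \<times> I \<in> sets site_time" unfolding site_time_def using I by auto
  have "emeasure site_time (V \<times> I) = emeasure (count_space UNIV) V * emeasure (restrict_space lborel {0..}) I"
    unfolding site_time_def by (rule time.emeasure_pair_measure_Times) (use I in auto)
  then show "emeasure site_time (V \<times> I) = of_nat (card V) * emeasure lborel I"
    using assms by (simp add: emeasure_restrict_space emeasure_count_space)
qed

section \<open>Probability of a set of requirements\<close>

primrec mark_of_pair :: "mark \<Rightarrow> bool \<times> bool \<Rightarrow> bool" where
  "mark_of_pair Sticky = fst"
| "mark_of_pair Block = snd"

context bernoulli_ballistic_deposition
begin

primrec rate :: "mark \<Rightarrow> real" where
  "rate Sticky = p"
| "rate Block = \<sigma>"

definition marks :: "'w \<Rightarrow> int \<times> nat \<Rightarrow> bool \<times> bool" where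
  "marks \<omega> = (\<lambda>(x, n). (\<epsilon> \<omega> (x, arrival (\<xi> \<omega>) x n), \<eta> \<omega> (x, arrival (\<xi> \<omega>) x n)))"

lemma mark_at_eq: "mark_at (\<epsilon> \<omega>) (\<eta> \<omega>) mk (x, arrival (\<xi> \<omega>) x n) = mark_of_pair mk (marks \<omega> (x, n))"
  by (cases mk) (simp_all add: marks_def)

lemma rate_pos: "0 < rate mk"
  by (cases mk) (use p \<sigma> in auto)

lemma indep_marks: "indep_vars (\<lambda>_. count_space UNIV) (\<lambda>i \<omega>. marks \<omega> i) UNIV"
  using marks_indep unfolding marks_def by (simp add: case_prod_unfold)

lemma marks_measurable [measurable]: "(\<lambda>\<omega>. marks \<omega> i) \<in> measurable M (count_space UNIV)"
  using indep_marks unfolding indep_vars_def by blast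

lemma prob_mark: "prob {\<omega> \<in> space M. mark_of_pair mk (marks \<omega> i)} = rate mk"
proof -
  obtain x n where i: "i = (x, n)" by (cases i)
  let ?K = "{q. mark_of_pair mk q}"
  have "prob {\<omega> \<in> space M. mark_of_pair mk (marks \<omega> i)} = prob ((\<lambda>\<omega>. marks \<omega> i) -` ?K \<inter> space M)"
    by (simp add: vimage_def Int_def conj_commute)
  also have "\<dots> = measure (distr M (count_space UNIV) (\<lambda>\<omega>. marks \<omega> i)) ?K"
    by (subst measure_distr) auto
  also have "distr M (count_space UNIV) (\<lambda>\<omega>. marks \<omega> i) = measure_pmf (pair_pmf (bernoulli_pmf p) (bernoulli_pmf \<sigma>))"
    unfolding i using mark_distr[of x n] by (simp add: marks_def)
  also have "measure_pmf.prob (pair_pmf (bernoulli_pmf p) (bernoulli_pmf \<sigma>)) ?K = rate mk"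
  proof (cases mk)
    case Sticky
    have "measure_pmf.prob (pair_pmf (bernoulli_pmf p) (bernoulli_pmf \<sigma>)) ?K
        = measure_pmf.prob (map_pmf fst (pair_pmf (bernoulli_pmf p) (bernoulli_pmf \<sigma>))) {True}"
      by (simp add: Sticky vimage_def)
    then show ?thesis using p Sticky by (simp add: map_fst_pair_pmf measure_pmf_single)
  next
    case Block
    have "measure_pmf.prob (pair_pmf (bernoulli_pmf p) (bernoulli_pmf \<sigma>)) ?K
        = measure_pmf.prob (map_pmf snd (pair_pmf (bernoulli_pmf p) (bernoulli_pmf \<sigma>))) {True}"
      by (simp add: Block vimage_def)
    then show ?thesis using \<sigma> Block by (simp add: map_snd_pair_pmf measure_pmf_single)
  qed
  finally show ?thesis .
qed

lemma prob_marks_indep: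
  assumes S: "finite S" and inj: "inj_on i S"
  shows "prob {\<omega> \<in> space M. \<forall>r\<in>S. mark_of_pair (f r) (marks \<omega> (i r))} = (\<Prod>r\<in>S. rate (f r))"
proof (cases "S = {}")
  case False
  let ?K = "\<lambda>c. {q. mark_of_pair (f (the_inv_into S i c)) q}"
  let ?E = "\<lambda>r. {\<omega> \<in> space M. mark_of_pair (f r) (marks \<omega> (i r))}"
  have E: "(\<lambda>\<omega>. marks \<omega> (i r)) -` ?K (i r) \<inter> space M = ?E r" if "r \<in> S" for r
    using the_inv_into_f_f[OF inj that] by auto
  have "prob (\<Inter>c\<in>i ` S. (\<lambda>\<omega>. marks \<omega> c) -` ?K c \<inter> space M)
      = (\<Prod>c\<in>i ` S. prob ((\<lambda>\<omega>. marks \<omega> c) -` ?K c \<inter> space M))"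
    using False S by (intro indep_varsD[OF indep_marks]) auto
  also have "\<dots> = (\<Prod>r\<in>S. rate (f r))"
    unfolding prod.reindex[OF inj] o_def by (rule prod.cong[OF refl]) (simp only: E prob_mark)
  also have "(\<Inter>c\<in>i ` S. (\<lambda>\<omega>. marks \<omega> c) -` ?K c \<inter> space M) = (\<Inter>r\<in>S. ?E r)"
    by (simp only: image_image) (rule INF_cong[OF refl E])
  also have "(\<Inter>r\<in>S. ?E r) = {\<omega> \<in> space M. \<forall>r\<in>S. mark_of_pair (f r) (marks \<omega> (i r))}"
    using False by auto
  finally show ?thesis .
qed (simp add: prob_space)

lemma cell_set_measurable:
  assumes "0 < d"
  shows "cell_set d c \<in> sets site_time" "emeasure site_time (cell_set d c) = ennreal d"
proof -
  have "0 \<le> real (snd c) * d" using assms by simp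
  then have *: "{real (snd c) * d<..real (Suc (snd c)) * d} \<subseteq> {0..}" by (meson greaterThanAtMost_iff atLeast_iff less_imp_le order_trans subsetI)
  show "cell_set d c \<in> sets site_time" "emeasure site_time (cell_set d c) = ennreal d"
    unfolding cell_set_def using site_time_rectangle[OF _ _ *, of "{fst c}"] assms
    by (simp_all add: algebra_simps)
qed

lemma before_set_measurable: "before_set d c \<in> sets site_time"
  unfolding before_set_def by (rule site_time_rectangle(1)) auto

lemma occurs_iff:
  "occurs d (\<xi> \<omega>) (\<epsilon> \<omega>) (\<eta> \<omega>) r \<longleftrightarrow>
    (\<exists>n. num_points (\<xi> \<omega>) (before_set d (fst r)) = enat n \<and>
     num_points (\<xi> \<omega>) (cell_set d (fst r)) = 1 \<and> mark_of_pair (snd r) (marks \<omega> (fst (fst r), n)))"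
  unfolding occurs_def mark_at_eq ..

lemma occurs_measurable:
  assumes "0 < d"
  shows "{\<omega> \<in> space M. occurs d (\<xi> \<omega>) (\<epsilon> \<omega>) (\<eta> \<omega>) r} \<in> events"
proof -
  note [measurable] = count_measurable[OF before_set_measurable] count_measurable[OF cell_set_measurable(1)[OF assms]]
  show ?thesis unfolding occurs_iff by measurable
qed

lemma marks_event_vimage:
  assumes S: "finite S"
  shows "{\<omega> \<in> space M. \<forall>r\<in>S. mark_of_pair (f r) (marks \<omega> (i r))}
    \<in> sets (vimage_algebra (space M) marks (Pi\<^sub>M UNIV (\<lambda>_. count_space UNIV)))"
proof -
  let ?F = "{m \<in> space (Pi\<^sub>M UNIV (\<lambda>_. count_space UNIV)). \<forall>r\<in>S. mark_of_pair (f r) (m (i r))}"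
  have "?F \<in> sets (Pi\<^sub>M UNIV (\<lambda>_ :: int \<times> nat. count_space (UNIV :: (bool \<times> bool) set)))"
    by (rule sets.sets_Collect_finite_All[OF _ S]) measurable
  then have "marks -` ?F \<inter> space M \<in> sets (vimage_algebra (space M) marks (Pi\<^sub>M UNIV (\<lambda>_. count_space UNIV)))"
    by (rule in_vimage_algebra)
  moreover have "marks -` ?F \<inter> space M = {\<omega> \<in> space M. \<forall>r\<in>S. mark_of_pair (f r) (marks \<omega> (i r))}"
    by (auto simp: space_PiM)
  ultimately show ?thesis by simp
qed

lemma prob_points_marks:
  assumes "A \<in> sets (vimage_algebra (space M) \<xi> (config_space site_time))"
    and "B \<in> sets (vimage_algebra (space M) marks (Pi\<^sub>M UNIV (\<lambda>_. count_space UNIV)))"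
  shows "prob (A \<inter> B) = prob A * prob B"
proof -
  have "marks = (\<lambda>\<omega> (x, n). (\<epsilon> \<omega> (x, arrival (\<xi> \<omega>) x n), \<eta> \<omega> (x, arrival (\<xi> \<omega>) x n)))"
    by (simp add: marks_def fun_eq_iff)
  then show ?thesis using indep_setD[OF marks_indep_points, of A B] assms by simp
qed

text \<open>Decompose according to the arrival indices \<open>n r\<close> of the points in question. On each part \<open>A n\<close>, which depends
on the points only, the required marks sit at fixed indices; these indices are distinct because two
cells of one column contain different points, so the marks contribute exactly the product of their
rates, whatever \<open>n\<close> is. Summing over \<open>n\<close> leaves the probability that every cell
contains exactly one point, which is at most \<open>d\<close> per cell.\<close>

lemma prob_all_occur:
  assumes d: "0 < d" and S: "finite S" and inj: "inj_on fst S"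
  shows "prob {\<omega> \<in> space M. \<forall>r\<in>S. occurs d (\<xi> \<omega>) (\<epsilon> \<omega>) (\<eta> \<omega>) r} \<le> weight (\<lambda>mk. rate mk * d) S"
proof -
  define I where "I = (Pi\<^sub>E S (\<lambda>_. UNIV) :: (cell \<times> mark \<Rightarrow> nat) set)"
  define A where "A n = {\<omega> \<in> space M. \<forall>r\<in>S. num_points (\<xi> \<omega>) (before_set d (fst r)) = enat (n r) \<and>
      num_points (\<xi> \<omega>) (cell_set d (fst r)) = 1}" for n
  define B where "B n = {\<omega> \<in> space M. \<forall>r\<in>S. mark_of_pair (snd r) (marks \<omega> (fst (fst r), n r))}" for n
  define q where "q = (\<Prod>r\<in>S. rate (snd r))"
  have "countable I" unfolding I_def using S by (intro countable_PiE) auto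
  note [measurable] = count_measurable[OF before_set_measurable] count_measurable[OF cell_set_measurable(1)[OF d]]
  have A_meas [measurable]: "A n \<in> events" for n unfolding A_def using S by measurable
  have B_meas [measurable]: "B n \<in> events" for n unfolding B_def using S by measurable
  have q0: "0 \<le> q" unfolding q_def by (intro prod_nonneg) (use rate_pos less_imp_le in auto)
  have AB: "emeasure M (A n \<inter> B n) \<le> ennreal q * emeasure M (A n)" for n
  proof (cases "A n = {}")
    case False
    then obtain \<omega> where \<omega>: "\<omega> \<in> A n" by auto
    have less: "n r < n s"
      if "r \<in> S" "s \<in> S" "fst (fst r) = fst (fst s)" "snd (fst r) < snd (fst s)" for r s
    proof -
      let ?b = "\<lambda>r. \<xi> \<omega> \<inter> before_set d (fst r)" and ?c = "\<xi> \<omega> \<inter> cell_set d (fst r)"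
      have fin: "finite (?b r)" "finite (?b s)" "card (?b r) = n r" "card (?b s) = n s" "?c \<noteq> {}"
        using \<omega> that(1,2) by (auto simp: A_def num_points_def zero_enat_def one_enat_def split: if_splits)
      have "real (Suc (snd (fst r))) * d \<le> real (snd (fst s)) * d" "0 \<le> real (snd (fst r)) * d"
        "real (snd (fst r)) * d \<le> real (Suc (snd (fst r))) * d"
        using that(4) d by (auto intro!: mult_right_mono)
      then have "?b r \<union> ?c \<subseteq> ?b s" "?b r \<inter> ?c = {}"
        using that(3) unfolding before_set_def cell_set_def by fastforce+
      then have "?b r \<subset> ?b s" using fin(5) by blast
      then show ?thesis using psubset_card_mono[OF fin(2)] fin(3,4) by metis
    qed
    \<comment> \<open>Within a column the index determines the slot, so different requirements concern different marks.\<close>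
    have "inj_on (\<lambda>r. (fst (fst r), n r)) S"
    proof (rule inj_onI)
      fix r s assume rs: "r \<in> S" "s \<in> S" "(fst (fst r), n r) = (fst (fst s), n s)"
      then have "snd (fst r) = snd (fst s)"
        using less[of r s] less[of s r] by (cases "snd (fst r)" "snd (fst s)" rule: linorder_cases) auto
      with rs have "fst r = fst s" by (simp add: prod_eq_iff)
      with rs inj show "r = s" by (auto dest: inj_onD)
    qed
    then have "prob (B n) = q" unfolding B_def q_def by (rule prob_marks_indep[OF S])
    moreover have "prob (A n \<inter> B n) = prob (A n) * prob (B n)"
    proof (rule prob_points_marks)
      let ?V = "vimage_algebra (space M) \<xi> (config_space site_time)"
      have "{\<omega> \<in> space ?V. \<forall>r\<in>S. num_points (\<xi> \<omega>) (before_set d (fst r)) = enat (n r) \<and>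
          num_points (\<xi> \<omega>) (cell_set d (fst r)) = 1} \<in> sets ?V"
        by (intro sets.sets_Collect_finite_All[OF _ S] sets.sets_Collect_conj)
          (simp_all add: count_event_vimage before_set_measurable cell_set_measurable(1)[OF d])
      then show "A n \<in> sets ?V" by (simp add: A_def)
      show "B n \<in> sets (vimage_algebra (space M) marks (Pi\<^sub>M UNIV (\<lambda>_. count_space UNIV)))"
        unfolding B_def by (rule marks_event_vimage[OF S])
    qed
    ultimately show ?thesis using q0 by (simp add: emeasure_eq_measure ennreal_mult'' mult.commute)
  qed simp
  have disj: "disjoint_family_on A I"
  proof (unfold disjoint_family_on_def, intro ballI impI)
    fix m n assume "m \<in> I" "n \<in> I" "m \<noteq> n"
    then obtain r where "r \<in> S" "m r \<noteq> n r" unfolding I_def by (metis PiE_ext)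
    then show "A m \<inter> A n = {}" by (auto simp: A_def)
  qed
  have "emeasure M {\<omega> \<in> space M. \<forall>r\<in>S. occurs d (\<xi> \<omega>) (\<epsilon> \<omega>) (\<eta> \<omega>) r} \<le> emeasure M (\<Union>n\<in>I. A n \<inter> B n)"
  proof (rule emeasure_mono)
    show "{\<omega> \<in> space M. \<forall>r\<in>S. occurs d (\<xi> \<omega>) (\<epsilon> \<omega>) (\<eta> \<omega>) r} \<subseteq> (\<Union>n\<in>I. A n \<inter> B n)"
    proof
      fix \<omega> assume \<omega>: "\<omega> \<in> {\<omega> \<in> space M. \<forall>r\<in>S. occurs d (\<xi> \<omega>) (\<epsilon> \<omega>) (\<eta> \<omega>) r}"
      then obtain n where n: "\<forall>r\<in>S. num_points (\<xi> \<omega>) (before_set d (fst r)) = enat (n r) \<and>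
          num_points (\<xi> \<omega>) (cell_set d (fst r)) = 1 \<and> mark_of_pair (snd r) (marks \<omega> (fst (fst r), n r))"
        unfolding occurs_iff by (auto dest!: bchoice)
      then have "restrict n S \<in> I" "\<omega> \<in> A (restrict n S) \<inter> B (restrict n S)"
        using \<omega> by (auto simp: I_def A_def B_def)
      then show "\<omega> \<in> (\<Union>n\<in>I. A n \<inter> B n)" by blast
    qed
    show "(\<Union>n\<in>I. A n \<inter> B n) \<in> events" using \<open>countable I\<close> by (intro sets.countable_UN') auto
  qed
  also have "\<dots> = (\<integral>\<^sup>+n. emeasure M (A n \<inter> B n) \<partial>count_space I)"
    using disj \<open>countable I\<close> by (intro emeasure_UN_countable) (auto simp: disjoint_family_on_def)
  also have "\<dots> \<le> (\<integral>\<^sup>+n. ennreal q * emeasure M (A n) \<partial>count_space I)"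
    by (intro nn_integral_mono AB)
  also have "\<dots> = ennreal q * emeasure M (\<Union>n\<in>I. A n)"
    using disj \<open>countable I\<close> by (subst emeasure_UN_countable) (auto simp: nn_integral_cmult)
  also have "\<dots> \<le> ennreal q * emeasure M {\<omega> \<in> space M. \<forall>r\<in>S. num_points (\<xi> \<omega>) (cell_set d (fst r)) \<in> {1}}"
    using S by (intro mult_left_mono emeasure_mono) (auto simp: A_def)
  also have "\<dots> \<le> ennreal q * ennreal (d ^ card S)"
  proof -
    have "disjoint_family_on (\<lambda>r. cell_set d (fst r)) S"
    proof (unfold disjoint_family_on_def, intro ballI impI)
      fix r s assume "r \<in> S" "s \<in> S" "r \<noteq> s"
      then have "fst r \<noteq> fst s" using inj by (auto dest: inj_onD)
      have "real (Suc i) * d \<le> real j * d" if "i < j" for i j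
        using that d by (auto intro!: mult_right_mono)
      then have slots: "{real i * d<..real (Suc i) * d} \<inter> {real j * d<..real (Suc j) * d} = {}" if "i \<noteq> j" for i j
        using that by (cases i j rule: linorder_cases) (fastforce simp del: of_nat_Suc)+
      show "cell_set d (fst r) \<inter> cell_set d (fst s) = {}"
      proof (cases "fst (fst r) = fst (fst s)")
        case True
        with \<open>fst r \<noteq> fst s\<close> have neq: "snd (fst r) \<noteq> snd (fst s)" by (simp add: prod_eq_iff)
        show ?thesis unfolding cell_set_def Times_Int_Times slots[OF neq] by (rule Sigma_empty2)
      qed (auto simp: cell_set_def)
    qed
    then have "prob {\<omega> \<in> space M. \<forall>r\<in>S. num_points (\<xi> \<omega>) (cell_set d (fst r)) \<in> {1}}
        = (\<Prod>r\<in>S. prob {\<omega> \<in> space M. num_points (\<xi> \<omega>) (cell_set d (fst r)) \<in> {1}})"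
      by (intro prob_counts_indep[OF S] cell_set_measurable(1)[OF d])
    also have "\<dots> \<le> (\<Prod>r\<in>S. d)"
      using prob_one_point_le[OF cell_set_measurable(1)[OF d] d cell_set_measurable(2)[OF d]]
      by (intro prod_mono) auto
    finally have "prob {\<omega> \<in> space M. \<forall>r\<in>S. num_points (\<xi> \<omega>) (cell_set d (fst r)) \<in> {1}} \<le> d ^ card S" by simp
    then show ?thesis unfolding emeasure_eq_measure by (intro mult_left_mono ennreal_leI) auto
  qed
  also have "\<dots> = ennreal (weight (\<lambda>mk. rate mk * d) S)"
    using q0 d by (simp add: weight_def q_def prod.distrib ennreal_mult'' )
  finally show ?thesis
    unfolding emeasure_eq_measure using less_imp_le[OF rate_pos] d
    by (subst (asm) ennreal_le_iff) (auto intro: weight_nonneg)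
qed

end

section \<open>Tail of the height in terms of the discretisation\<close>

context bernoulli_ballistic_deposition
begin

lemma prob_no_empty_column:
  assumes T: "0 < T" and V: "finite V"
  shows "prob {\<omega> \<in> space M. \<forall>x\<in>V. num_points (\<xi> \<omega>) ({x} \<times> {0<..T}) \<in> - {0}} = (1 - exp (- T)) ^ card V"
proof -
  have sub: "{0<..T} \<subseteq> {0..}" by auto
  have col: "{x} \<times> {0<..T} \<in> sets site_time" "emeasure site_time ({x} \<times> {0<..T}) = ennreal T" for x
    using site_time_rectangle[OF _ _ sub, of "{x}"] T by auto
  have "prob {\<omega> \<in> space M. num_points (\<xi> \<omega>) ({x} \<times> {0<..T}) \<in> - {0}} = 1 - exp (- T)" for x
  proof -
    note count_measurable[OF col(1), measurable]
    show ?thesis using prob_neg[of "\<lambda>\<omega>. num_points (\<xi> \<omega>) ({x} \<times> {0<..T}) = 0"]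
      by (simp add: prob_no_point[OF col(1) T col(2)])
  qed
  moreover have "disjoint_family_on (\<lambda>x. {x} \<times> {0<..T}) V"
    by (auto simp: disjoint_family_on_def)
  ultimately show ?thesis using prob_counts_indep[OF V, of "\<lambda>x. {x} \<times> {0<..T}" "\<lambda>_. - {0}"] col(1) by simp
qed

lemma AE_locally_finite: "AE \<omega> in M. \<forall>x t. finite {s. (x, s) \<in> \<xi> \<omega> \<and> s < t}"
proof -
  have "AE \<omega> in M. \<forall>x. \<forall>n. finite (\<xi> \<omega> \<inter> {x} \<times> {0..real (Suc n)})"
    unfolding AE_all_countable
  proof (intro allI)
    fix x n
    show "AE \<omega> in M. finite (\<xi> \<omega> \<inter> {x} \<times> {0..real (Suc n)})"
      using site_time_rectangle[of "{x}" "{0..real (Suc n)}"]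
      by (intro AE_finite_points[of _ "real (Suc n)"]) auto
  qed
  with AE_space show ?thesis
  proof eventually_elim
    case (elim \<omega>)
    show ?case
    proof (intro allI)
      fix x t
      obtain n where n: "t \<le> real n" using real_arch_simple by blast
      have "\<xi> \<omega> \<subseteq> space site_time"
        using measurable_space[OF point_process elim(1)] by (simp add: config_space_def space_measure_of_conv)
      then have "Pair x ` {s. (x, s) \<in> \<xi> \<omega> \<and> s < t} \<subseteq> \<xi> \<omega> \<inter> {x} \<times> {0..real (Suc n)}"
        using n by (auto simp: site_time_def space_pair_measure space_restrict_space)
      then have "finite (Pair x ` {s. (x, s) \<in> \<xi> \<omega> \<and> s < t})"
        using elim(2) finite_subset by blast
      then show "finite {s. (x, s) \<in> \<xi> \<omega> \<and> s < t}"
        by (rule finite_imageD) (simp add: inj_on_def)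
    qed
  qed
qed

text \<open>Apart from the requirement sets of the two union bounds, the exceptional events are \<open>E1\<close>, that one
side of the box has no empty column, and \<open>E2\<close>, that some slot contains two points of the box.
The threshold \<open>J\<close> separates long paths (\<open>E4\<close>) from chains of bounded displacement (\<open>E3\<close>).\<close>

lemma prob_height_grid:
  assumes T: "0 < T" and N: "0 < N" and k: "0 < k"
  defines "d \<equiv> T / real N"
  shows "prob {\<omega> \<in> space M. k \<le> h \<omega> T 0} \<le>
    2 * (1 - exp (- T)) ^ R + real N * (real (2 * R + 1) * d)\<^sup>2
    + (2 * (\<sigma> * d)) ^ k * real (N choose k) * real (J + k choose k)
    + (\<Sum>m\<in>{J<..<N}. \<sigma> * d * (2 * (p * d)) ^ m * real (N choose Suc m))"
proof -
  have d: "0 < d" "real N * d = T" using T N by (auto simp: d_def)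
  let ?w = "\<lambda>mk. rate mk * d"
  have w: "0 \<le> ?w mk" for mk using rate_pos[of mk] d(1) by simp
  define W where "W V = {\<omega> \<in> space M. \<forall>x\<in>V. num_points (\<xi> \<omega>) ({x} \<times> {0<..T}) \<in> - {0}}" for V
  define box where "box j = {- int R..int R} \<times> {real j * d<..real (Suc j) * d}" for j
  define crowd where "crowd j = {\<omega> \<in> space M. \<not> num_points (\<xi> \<omega>) (box j) \<le> 1}" for j
  define occ where "occ S = {\<omega> \<in> space M. \<forall>r\<in>S. occurs d (\<xi> \<omega>) (\<epsilon> \<omega>) (\<eta> \<omega>) r}" for S
  define E1 where "E1 = W {- int R..-1} \<union> W {1..int R}"
  define E2 where "E2 = (\<Union>j\<in>{..<N}. crowd j)"
  define E3 where "E3 = (\<Union>S\<in>block_chains k N 0 J. occ S)"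
  define E4 where "E4 = (\<Union>m\<in>{J<..<N}. \<Union>S\<in>jump_paths N 0 m. occ S)"
  have box: "box j \<in> sets site_time" "emeasure site_time (box j) = ennreal (real (2 * R + 1) * d)" for j
  proof -
    have "0 \<le> real j * d" using d by simp
    then have sub: "{real j * d<..real (Suc j) * d} \<subseteq> {0..}" by auto
    have len: "real (Suc j) * d - real j * d = d" by (simp add: algebra_simps)
    have "emeasure site_time (box j) = of_nat (card {- int R..int R}) * emeasure lborel {real j * d<..real (Suc j) * d}"
      unfolding box_def by (rule site_time_rectangle(2)[OF _ _ sub]) auto
    also have "emeasure lborel {real j * d<..real (Suc j) * d} = ennreal d"
      using d by (subst emeasure_lborel_Ioc) (simp_all only: len, simp)
    also have "of_nat (card {- int R..int R}) * ennreal d = ennreal (real (2 * R + 1) * d)"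
    proof -
      have "card {- int R..int R} = 2 * R + 1" by simp
      then show ?thesis using d by (simp only: ennreal_mult'' less_imp_le ennreal_of_nat_eq_real_of_nat)
    qed
    finally show "emeasure site_time (box j) = ennreal (real (2 * R + 1) * d)" .
    show "box j \<in> sets site_time" unfolding box_def by (rule site_time_rectangle(1)[OF _ _ sub]) auto
  qed
  have col: "{x} \<times> {0<..T} \<in> sets site_time" for x
    by (rule site_time_rectangle(1)) auto
  have W_meas [measurable]: "W V \<in> events" if "finite V" for V
    unfolding W_def using that by (intro sets.sets_Collect_finite_All count_event[OF col])
  have crowd_meas [measurable]: "crowd j \<in> events" for j
    unfolding crowd_def by (rule count_event[OF box(1)])
  have occ_meas: "occ S \<in> events" if "admissible j S" for j S
    unfolding occ_def using that occurs_measurable[OF d(1)]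
    by (intro sets.sets_Collect_finite_All) (auto simp: admissible_def)
  have chain_meas: "occ ` block_chains k N 0 J \<subseteq> events" and path_meas: "occ ` jump_paths N 0 m \<subseteq> events" for m
    using occ_meas block_chains_admissible jump_paths_admissible by blast+
  have E_meas: "E1 \<in> events" "E2 \<in> events" "E3 \<in> events" "E4 \<in> events"
    unfolding E1_def E2_def E3_def E4_def using chain_meas path_meas W_meas crowd_meas
    by (auto intro!: sets.finite_UN finite_block_chains finite_jump_paths)
  have occ_le: "prob (occ S) \<le> weight ?w S" if "admissible j S" for j S
    unfolding occ_def using that by (intro prob_all_occur[OF d(1)]) (auto simp: admissible_def)
  have "prob E1 \<le> prob (W {- int R..-1}) + prob (W {1..int R})"
    unfolding E1_def by (intro measure_Un_le) auto
  also have "\<dots> = 2 * (1 - exp (- T)) ^ R"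
    unfolding W_def by (subst (1 2) prob_no_empty_column[OF T]) auto
  finally have E1: "prob E1 \<le> 2 * (1 - exp (- T)) ^ R" .
  have "prob E2 \<le> (\<Sum>j<N. prob (crowd j))"
    unfolding E2_def by (intro finite_measure_subadditive_finite) auto
  also have "\<dots> \<le> (\<Sum>j<N. (real (2 * R + 1) * d)\<^sup>2)"
    unfolding crowd_def using d(1) by (intro sum_mono prob_two_points_le[OF box(1) _ box(2)]) simp
  finally have E2: "prob E2 \<le> real N * (real (2 * R + 1) * d)\<^sup>2" by simp
  have "prob E3 \<le> (\<Sum>S\<in>block_chains k N 0 J. prob (occ S))"
    unfolding E3_def by (intro finite_measure_subadditive_finite finite_block_chains chain_meas)
  also have "\<dots> \<le> sum (weight ?w) (block_chains k N 0 J)"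
    by (intro sum_mono occ_le block_chains_admissible)
  also have "\<dots> \<le> (2 * ?w Block) ^ k * real (N choose k) * real (J + k choose k)"
    by (rule sum_weight_block_chains[OF w])
  finally have E3: "prob E3 \<le> (2 * (\<sigma> * d)) ^ k * real (N choose k) * real (J + k choose k)" by simp
  have "prob E4 \<le> (\<Sum>m\<in>{J<..<N}. prob (\<Union>S\<in>jump_paths N 0 m. occ S))"
    unfolding E4_def using path_meas
    by (intro finite_measure_subadditive_finite) (auto intro!: sets.finite_UN finite_jump_paths)
  also have "\<dots> \<le> (\<Sum>m\<in>{J<..<N}. \<Sum>S\<in>jump_paths N 0 m. prob (occ S))"
    by (intro sum_mono finite_measure_subadditive_finite finite_jump_paths path_meas)
  also have "\<dots> \<le> (\<Sum>m\<in>{J<..<N}. sum (weight ?w) (jump_paths N 0 m))"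
    by (intro sum_mono occ_le jump_paths_admissible)
  also have "\<dots> \<le> (\<Sum>m\<in>{J<..<N}. ?w Block * (2 * ?w Sticky) ^ m * real (N choose Suc m))"
    by (intro sum_mono sum_weight_jump_paths[OF w])
  finally have E4: "prob E4 \<le> (\<Sum>m\<in>{J<..<N}. \<sigma> * d * (2 * (p * d)) ^ m * real (N choose Suc m))" by simp
  have "AE \<omega> in M. \<omega> \<in> {\<omega> \<in> space M. k \<le> h \<omega> T 0} \<longrightarrow> \<omega> \<in> E1 \<union> E2 \<union> E3 \<union> E4"
    using evolution AE_locally_finite AE_space
  proof eventually_elim
    case (elim \<omega>)
    show ?case
    proof (intro impI, rule ccontr)
      assume "\<omega> \<in> {\<omega> \<in> space M. k \<le> h \<omega> T 0}" and "\<omega> \<notin> E1 \<union> E2 \<union> E3 \<union> E4"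
      then have kh: "k \<le> h \<omega> T 0" and notin: "\<omega> \<notin> E1" "\<omega> \<notin> E2" "\<omega> \<notin> E3" "\<omega> \<notin> E4" by auto
      have empty: "(x, u) \<notin> \<xi> \<omega>" if "num_points (\<xi> \<omega>) ({x} \<times> {0<..T}) = 0" "0 < u" "u \<le> real N * d" for x u
      proof -
        have "\<xi> \<omega> \<inter> {x} \<times> {0<..T} = {}"
          using that(1) by (auto simp: num_points_def zero_enat_def split: if_splits)
        then show ?thesis using that(2,3) d(2) by auto
      qed
      obtain l r where "l \<in> {- int R..-1}" "num_points (\<xi> \<omega>) ({l} \<times> {0<..T}) = 0"
        "r \<in> {1..int R}" "num_points (\<xi> \<omega>) ({r} \<times> {0<..T}) = 0"
        using notin(1) elim(3) by (auto simp: E1_def W_def)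
      then have l: "- int R \<le> l" "l < 0" "num_points (\<xi> \<omega>) ({l} \<times> {0<..T}) = 0"
        and r: "0 < r" "r \<le> int R" "num_points (\<xi> \<omega>) ({r} \<times> {0<..T}) = 0"
        by auto
      have "\<xi> \<omega> \<subseteq> space site_time"
        using measurable_space[OF point_process elim(3)] by (simp add: config_space_def space_measure_of_conv)
      then have nonneg: "0 \<le> s" if "(x, s) \<in> \<xi> \<omega>" for x s
        using that by (auto simp: site_time_def space_pair_measure space_restrict_space)
      have slots: "num_points (\<xi> \<omega>) ({- int R..int R} \<times> {real j * d<..real (Suc j) * d}) \<le> 1" if "j < N" for j
        using notin(2) elim(3) that by (auto simp: E2_def crowd_def box_def)
      have "\<exists>m. (\<exists>S\<in>jump_paths N 0 m. \<forall>r\<in>S. occurs d (\<xi> \<omega>) (\<epsilon> \<omega>) (\<eta> \<omega>) r) \<and>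
             (\<exists>S\<in>block_chains k N 0 m. \<forall>r\<in>S. occurs d (\<xi> \<omega>) (\<epsilon> \<omega>) (\<eta> \<omega>) r)"
        using elim(2) kh d(2)
        by (intro evolution_imp_paths[OF elim(1) _ nonneg d(1) slots l(1,2) empty[OF l(3)] r(1,2) empty[OF r(3)] k]) auto
      then obtain m S S' where S: "S \<in> jump_paths N 0 m" "\<forall>r\<in>S. occurs d (\<xi> \<omega>) (\<epsilon> \<omega>) (\<eta> \<omega>) r"
        and S': "S' \<in> block_chains k N 0 m" "\<forall>r\<in>S'. occurs d (\<xi> \<omega>) (\<epsilon> \<omega>) (\<eta> \<omega>) r" by blast
      show False
      proof (cases "m \<le> J")
        case True
        then have "S' \<in> block_chains k N 0 J" using S'(1) block_chains_mono[of N N m J k 0] by auto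
        then show False using notin(3) S'(2) elim(3) by (auto simp: E3_def occ_def)
      next
        case False
        moreover have "m < N" using S(1) jump_paths_empty[of N m 0] by (cases "m < N") auto
        ultimately have "m \<in> {J<..<N}" by simp
        moreover have "\<omega> \<in> occ S" using S(2) elim(3) by (simp add: occ_def)
        ultimately show False using notin(4) S(1) unfolding E4_def by blast
      qed
    qed
  qed
  then have "prob {\<omega> \<in> space M. k \<le> h \<omega> T 0} \<le> prob (E1 \<union> E2 \<union> E3 \<union> E4)"
    using E_meas by (intro finite_measure_mono_AE) auto
  also have "\<dots> \<le> prob E1 + prob E2 + prob E3 + prob E4"
    using E_meas measure_Un_le[of "E1 \<union> E2 \<union> E3" M E4]
      measure_Un_le[of "E1 \<union> E2" M E3] measure_Un_le[of E1 M E2] by auto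
  finally show ?thesis using E1 E2 E3 E4 by linarith
qed

end

section \<open>Estimates for the tail and its sum\<close>

lemma power_div_fact_le_exp:
  fixes y :: real
  assumes "0 \<le> y"
  shows "y ^ n / fact n \<le> exp y"
proof -
  have "(\<lambda>n. y ^ n / fact n) sums exp y"
    using exp_converges[of y] by (simp add: field_simps)
  then show ?thesis
    using sum_le_suminf[of "\<lambda>n. y ^ n / fact n" "{n}"] assms by (simp add: sums_iff)
qed

lemma binomial_mult_power_le:
  fixes y :: real
  assumes "0 \<le> y" "0 < n"
  shows "(y / real n) ^ k * real (n choose k) \<le> y ^ k / fact k"
proof -
  have "real (n choose k) * fact k \<le> real n ^ k"
    using binomial_fact_pow[of n k] by (metis of_nat_fact of_nat_le_iff of_nat_mult of_nat_power)
  then have "y ^ k * (real (n choose k) * fact k) \<le> y ^ k * real n ^ k"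
    using assms by (intro mult_left_mono) auto
  then show ?thesis using assms(2) by (simp add: power_divide field_simps)
qed

text \<open>Replacing \<open>y\<close> by \<open>2 y\<close> costs a factor \<open>exp (2 y) \<le> 16\<^sup>y\<close> and gains \<open>2\<close> to the power of the first index; the
\<open>4 y\<close> in that index pays for the cost.\<close>

lemma exponential_series_tail:
  fixes y :: real
  assumes y: "0 \<le> y"
  shows "(\<Sum>m\<in>{k + 4 * nat \<lceil>y\<rceil><..<N}. y ^ m / fact m) \<le> (1 / 2) ^ k"
proof -
  define n where "n = nat \<lceil>y\<rceil>"
  have yn: "y \<le> real n" by (simp add: n_def real_nat_ceiling_ge)
  have sums: "(\<lambda>m. (2 * y) ^ m / fact m) sums exp (2 * y)"
    using exp_converges[of "2 * y"] by (simp add: field_simps)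
  have "(\<Sum>m\<in>{k + 4 * n<..<N}. y ^ m / fact m)
      \<le> (\<Sum>m\<in>{k + 4 * n<..<N}. (1 / 2) ^ (k + 4 * n) * ((2 * y) ^ m / fact m))"
  proof (rule sum_mono)
    fix m assume m: "m \<in> {k + 4 * n<..<N}"
    have "y ^ m / fact m = (1 / 2) ^ m * ((2 * y) ^ m / fact m)"
      by (simp add: power_mult_distrib power_divide)
    also have "\<dots> \<le> (1 / 2) ^ (k + 4 * n) * ((2 * y) ^ m / fact m)"
      using m y by (intro mult_right_mono power_decreasing) auto
    finally show "y ^ m / fact m \<le> (1 / 2) ^ (k + 4 * n) * ((2 * y) ^ m / fact m)" .
  qed
  also have "\<dots> = (1 / 2) ^ (k + 4 * n) * (\<Sum>m\<in>{k + 4 * n<..<N}. (2 * y) ^ m / fact m)"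
    by (simp add: sum_distrib_left)
  also have "\<dots> \<le> (1 / 2) ^ (k + 4 * n) * exp (2 * y)"
    using sum_le_suminf[OF sums_summable[OF sums], of "{k + 4 * n<..<N}"] sums_unique[OF sums] y
    by (intro mult_left_mono) auto
  also have "\<dots> \<le> (1 / 2) ^ (k + 4 * n) * 16 ^ n"
  proof (intro mult_left_mono)
    have "exp (2 * y) \<le> exp (real n * 2)" using yn by simp
    also have "\<dots> = (exp 1 ^ 2) ^ n" by (simp add: exp_of_nat_mult exp_double[symmetric])
    also have "\<dots> \<le> (3 ^ 2 :: real) ^ n" by (intro power_mono exp_le) auto
    also have "\<dots> \<le> 16 ^ n" by (intro power_mono) auto
    finally show "exp (2 * y) \<le> 16 ^ n" .
  qed simp
  also have "\<dots> = (1 / 2) ^ k" by (simp add: power_add power_mult power_divide)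
  finally show ?thesis by (simp add: n_def)
qed

text \<open>Here \<open>s\<close> and \<open>a\<close> stand for \<open>\<sigma> T\<close> and \<open>\<sigma> p T\<^sup>2\<close>. For \<open>a \<le> 1\<close> every term of the tail carries a
factor \<open>a\<close>. For \<open>a \<ge> 1\<close> the first \<open>100 W\<close> terms are bounded by \<open>1\<close> and the remaining ones decay
geometrically, since \<open>(k\<^sup>2)\<^sup>k\<close> is at most \<open>9\<^sup>k (k!)\<^sup>2\<close>.\<close>

lemma summable_tail_bound:
  fixes s a W :: real
  assumes s: "0 \<le> s" "s \<le> W" "s \<le> a" and small: "a \<le> 1 \<Longrightarrow> a \<le> W"
    and large: "1 \<le> a \<Longrightarrow> a \<le> W\<^sup>2" "1 \<le> a \<Longrightarrow> 1 \<le> W"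
  shows "\<exists>f F. f sums F \<and> F \<le> (exp 84 + 102) * W \<and>
    (\<forall>k. 0 \<le> f k \<and> min 1 ((4 * s * real (Suc k) + 24 * a) ^ Suc k / (fact (Suc k))\<^sup>2 + s * (1 / 2) ^ Suc k) \<le> f k)"
proof -
  have a: "0 \<le> a" using s by simp
  have W: "0 \<le> W" using s by simp
  have kk: "real k ^ k / fact k \<le> 3 ^ k" for k
  proof -
    have "real k ^ k / fact k \<le> exp (real k)" by (rule power_div_fact_le_exp) simp
    also have "\<dots> = exp 1 ^ k" using exp_of_nat_mult[of k "1::real"] by simp
    also have "\<dots> \<le> 3 ^ k" by (intro power_mono exp_le) simp
    finally show ?thesis .
  qed
  have geo: "(\<lambda>k. c * (1 / 2) ^ Suc k) sums c" for c :: real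
    using sums_mult[OF power_half_series, of c] by simp
  show ?thesis
  proof (cases "a \<le> 1")
    case True
    define f where "f k = a * (84 ^ Suc k / fact (Suc k)) + s * (1 / 2) ^ Suc k" for k
    have "(\<lambda>k. 84 ^ k / fact k) sums exp (84 :: real)"
      using exp_converges[of "84 :: real"] by (simp add: field_simps)
    then have "(\<lambda>k. 84 ^ Suc k / fact (Suc k)) sums (exp 84 - 1 :: real)"
      by (subst sums_Suc_iff) simp
    then have "f sums (a * (exp 84 - 1) + s)"
      unfolding f_def by (intro sums_add sums_mult geo)
    moreover have "a * (exp 84 - 1) + s \<le> (exp 84 + 102) * W"
    proof -
      have "a * (exp 84 - 1) \<le> W * (exp 84 - 1)" using small[OF True] by (intro mult_right_mono) auto
      then show ?thesis using s(2) W by (simp add: algebra_simps)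
    qed
    moreover have "0 \<le> f k" for k using a s by (simp add: f_def)
    moreover have "(4 * s * real (Suc k) + 24 * a) ^ Suc k / (fact (Suc k))\<^sup>2 + s * (1 / 2) ^ Suc k \<le> f k" for k
    proof -
      let ?k = "Suc k"
      have "4 * s * real ?k + 24 * a \<le> 28 * a * real ?k"
      proof -
        have "s * real ?k \<le> a * real ?k" using s(3) by (intro mult_right_mono) auto
        moreover have "a * 1 \<le> a * real ?k" using a by (intro mult_left_mono) auto
        ultimately show ?thesis by linarith
      qed
      then have "(4 * s * real ?k + 24 * a) ^ ?k \<le> (28 * a * real ?k) ^ ?k"
        using s a by (intro power_mono) auto
      also have "\<dots> = a ^ ?k * 28 ^ ?k * real ?k ^ ?k" by (simp add: power_mult_distrib)
      finally have "(4 * s * real ?k + 24 * a) ^ ?k / (fact ?k)\<^sup>2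
          \<le> a ^ ?k * 28 ^ ?k * (real ?k ^ ?k / fact ?k) / fact ?k"
        by (simp add: power2_eq_square divide_right_mono del: power_Suc fact_Suc of_nat_Suc)
      also have "\<dots> \<le> a * 28 ^ ?k * 3 ^ ?k / fact ?k"
        using power_decreasing[of 1 ?k a] True a kk[of ?k]
        by (intro divide_right_mono mult_mono) (auto simp del: power_Suc fact_Suc of_nat_Suc)
      also have "\<dots> = a * (84 ^ ?k / fact ?k)"
        using power_mult_distrib[of "28 :: real" 3 ?k] by simp
      finally show ?thesis by (simp add: f_def)
    qed
    ultimately show ?thesis by (intro exI[of _ f] exI) (auto simp: min.coboundedI2)
  next
    case False
    then have aW: "a \<le> W\<^sup>2" and W1: "1 \<le> W" using large by auto
    define K where "K = nat \<lfloor>100 * W\<rfloor>"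
    define f where "f k = of_bool (k < K) + (1 + s) * (1 / 2) ^ Suc k" for k
    have "(\<lambda>k. of_bool (k < K) :: real) sums (\<Sum>k<K. 1)"
      using sums_If_finite_set[of "{..<K}" "\<lambda>_. 1 :: real"] by (simp add: of_bool_def)
    then have "f sums (real K + (1 + s))"
      unfolding f_def using sums_add[OF _ geo] by fastforce
    moreover have "real K + (1 + s) \<le> (exp 84 + 102) * W"
    proof -
      have "real K \<le> 100 * W" using W by (simp add: K_def)
      moreover have "0 \<le> exp 84 * W" using W by simp
      moreover have "(exp 84 + 102) * W = exp 84 * W + 102 * W" by (simp add: algebra_simps)
      ultimately show ?thesis using s(2) W1 by linarith
    qed
    moreover have "0 \<le> f k" for k using s by (simp add: f_def)
    moreover have "min 1 ((4 * s * real (Suc k) + 24 * a) ^ Suc k / (fact (Suc k))\<^sup>2 + s * (1 / 2) ^ Suc k) \<le> f k" for k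
    proof (cases "k < K")
      case True
      have "0 \<le> (1 + s) * (1 / 2) ^ Suc k" using s by simp
      then show ?thesis using True by (simp add: f_def)
    next
      case False
      let ?k = "Suc k"
      have Wk: "100 * W \<le> real ?k" using False W unfolding K_def by linarith
      have "4 * s * real ?k + 24 * a \<le> real ?k ^ 2 / 18"
      proof -
        define x where "x = real ?k"
        have "s * x \<le> (x / 100) * x" using Wk s(2) W by (intro mult_right_mono) (auto simp: x_def)
        then have "s * x \<le> x\<^sup>2 / 100" by (simp only: power2_eq_square times_divide_eq_left)
        moreover have "a \<le> (x / 100)\<^sup>2"
          unfolding x_def by (rule order_trans[OF aW power_mono]) (use Wk W in auto)
        then have "a \<le> x\<^sup>2 / 10000" by (simp add: power_divide)
        moreover have "0 \<le> x\<^sup>2" by simp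
        ultimately have "4 * (s * x) + 24 * a \<le> x\<^sup>2 / 18" by linarith
        then show ?thesis by (simp only: x_def mult.assoc)
      qed
      \<comment> \<open>The factor \<open>1/18\<close> leaves \<open>1/2\<close> after the loss of \<open>9\<close> from the factorials.\<close>
      then have "(4 * s * real ?k + 24 * a) ^ ?k \<le> (real ?k ^ 2 / 18) ^ ?k"
        using s a by (intro power_mono) auto
      then have "(4 * s * real ?k + 24 * a) ^ ?k / (fact ?k)\<^sup>2 \<le> (real ?k ^ 2 / 18) ^ ?k / (fact ?k)\<^sup>2"
        by (intro divide_right_mono) auto
      also have "\<dots> = (1 / 18) ^ ?k * (real ?k ^ ?k / fact ?k)\<^sup>2"
        by (simp add: power_divide power_mult_distrib power_mult[symmetric] mult.commute del: power_Suc fact_Suc of_nat_Suc)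
      also have "\<dots> \<le> (1 / 18) ^ ?k * (3 ^ ?k)\<^sup>2"
        using kk[of ?k] by (intro mult_left_mono power_mono) (auto simp del: power_Suc fact_Suc of_nat_Suc)
      also have "\<dots> = (1 / 2) ^ ?k"
      proof -
        have "(3 ^ ?k)\<^sup>2 = (9 :: real) ^ ?k" by (simp add: power2_eq_square power_mult_distrib[symmetric])
        then show ?thesis by (simp add: power_mult_distrib[symmetric] del: power_Suc)
      qed
      finally have "(4 * s * real ?k + 24 * a) ^ ?k / (fact ?k)\<^sup>2 \<le> (1 / 2) ^ ?k" .
      moreover have "f k = (1 / 2) ^ ?k + s * (1 / 2) ^ ?k"
        using False by (simp add: f_def distrib_right del: power_Suc)
      ultimately show ?thesis by (intro min.coboundedI2) linarith
    qed
    ultimately show ?thesis by (intro exI[of _ f] exI) auto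
  qed
qed

section \<open>Removing the discretisation and summing the tail\<close>

text \<open>The offset \<open>4 \<lceil>2 p T\<rceil>\<close> in the threshold makes long paths unlikely; the summand \<open>k\<close> makes their probability
summable in \<open>k\<close>, while changing the number of chains by at most an exponential factor in \<open>k\<close>. The errors
of the discretisation are removed by letting \<open>N\<close> and then \<open>R\<close> tend to infinity.\<close>

lemma (in bernoulli_ballistic_deposition) prob_height:
  assumes T: "0 < T" and k: "0 < k"
  shows "prob {\<omega> \<in> space M. k \<le> h \<omega> T 0} \<le>
    (2 * \<sigma> * T * real (2 * k + 4 * nat \<lceil>2 * p * T\<rceil>)) ^ k / (fact k)\<^sup>2 + \<sigma> * T * (1 / 2) ^ k"
    (is "?P \<le> ?B")
proof -
  define J where "J = k + 4 * nat \<lceil>2 * p * T\<rceil>"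
  have *: "?P \<le> 2 * (1 - exp (- T)) ^ R + (real (2 * R + 1) * T)\<^sup>2 / real N + ?B"
    if N: "0 < N" for N R
  proof -
    let ?d = "T / real N"
    have "(2 * (\<sigma> * ?d)) ^ k * real (N choose k) * real (J + k choose k) \<le>
        ((2 * \<sigma> * T) ^ k / fact k) * (real (J + k) ^ k / fact k)"
    proof (rule mult_mono)
      show "(2 * (\<sigma> * ?d)) ^ k * real (N choose k) \<le> (2 * \<sigma> * T) ^ k / fact k"
        using binomial_mult_power_le[of "2 * \<sigma> * T" N k] T \<sigma>(1) N by (simp add: mult.assoc)
      show "real (J + k choose k) \<le> real (J + k) ^ k / fact k"
        using binomial_mult_power_le[of "real (J + k)" "J + k" k] k by simp
    qed (use T \<sigma>(1) in auto)
    moreover have "(\<Sum>m\<in>{J<..<N}. \<sigma> * ?d * (2 * (p * ?d)) ^ m * real (N choose Suc m)) \<le> \<sigma> * T * (1 / 2) ^ k"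
    proof -
      have "\<sigma> * ?d * (2 * (p * ?d)) ^ m * real (N choose Suc m) \<le> \<sigma> * T * ((2 * p * T) ^ m / fact m)" for m
      proof -
        have "\<sigma> * ?d * (2 * (p * ?d)) ^ m * real (N choose Suc m)
            = \<sigma> * (2 * p) ^ m * (?d ^ Suc m * real (N choose Suc m))"
          by (simp only: power_mult_distrib power_Suc mult_ac)
        also have "\<dots> \<le> \<sigma> * (2 * p) ^ m * (T ^ Suc m / fact (Suc m))"
          using T p \<sigma> N by (intro mult_left_mono binomial_mult_power_le) auto
        also have "\<dots> \<le> \<sigma> * (2 * p) ^ m * (T ^ Suc m / fact m)"
          using T p \<sigma> by (intro mult_left_mono divide_left_mono fact_mono) auto
        also have "\<dots> = \<sigma> * T * ((2 * p * T) ^ m / fact m)"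
          by (simp add: power_mult_distrib algebra_simps)
        finally show ?thesis .
      qed
      then have "(\<Sum>m\<in>{J<..<N}. \<sigma> * ?d * (2 * (p * ?d)) ^ m * real (N choose Suc m))
          \<le> (\<Sum>m\<in>{J<..<N}. \<sigma> * T * ((2 * p * T) ^ m / fact m))"
        by (rule sum_mono)
      also have "\<dots> = \<sigma> * T * (\<Sum>m\<in>{J<..<N}. (2 * p * T) ^ m / fact m)"
        by (simp add: sum_distrib_left)
      also have "\<dots> \<le> \<sigma> * T * (1 / 2) ^ k"
        unfolding J_def using T p \<sigma> by (intro mult_left_mono exponential_series_tail) auto
      finally show ?thesis .
    qed
    moreover have "real N * (real (2 * R + 1) * ?d)\<^sup>2 = (real (2 * R + 1) * T)\<^sup>2 / real N"
      using N by (simp add: power2_eq_square field_simps)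
    moreover have "J + k = 2 * k + 4 * nat \<lceil>2 * p * T\<rceil>" by (simp add: J_def)
    ultimately show ?thesis
      using prob_height_grid[OF T N k, of R J] by (simp add: power_mult_distrib power2_eq_square)
  qed
  \<comment> \<open>For a fixed box the grid can be refined; only afterwards may the box grow.\<close>
  have **: "?P \<le> 2 * (1 - exp (- T)) ^ R + ?B" for R
  proof (rule LIMSEQ_le_const)
    have "(\<lambda>N. (real (2 * R + 1) * T)\<^sup>2 / real N) \<longlonglongrightarrow> 0" by (rule lim_const_over_n)
    then have "(\<lambda>N. 2 * (1 - exp (- T)) ^ R + (real (2 * R + 1) * T)\<^sup>2 / real N + ?B)
        \<longlonglongrightarrow> 2 * (1 - exp (- T)) ^ R + 0 + ?B"
      by (intro tendsto_intros)
    then show "(\<lambda>N. 2 * (1 - exp (- T)) ^ R + (real (2 * R + 1) * T)\<^sup>2 / real N + ?B)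
        \<longlonglongrightarrow> 2 * (1 - exp (- T)) ^ R + ?B" by simp
    show "\<exists>N0. \<forall>N\<ge>N0. ?P \<le> 2 * (1 - exp (- T)) ^ R + (real (2 * R + 1) * T)\<^sup>2 / real N + ?B"
      using * by (intro exI[of _ 1]) auto
  qed
  show ?thesis
  proof (rule LIMSEQ_le_const)
    have "exp (- T) < 1" "0 < exp (- T)" using T by simp_all
    then have "norm (1 - exp (- T)) < 1" unfolding real_norm_def by linarith
    then have "(\<lambda>R. (1 - exp (- T)) ^ R) \<longlonglongrightarrow> 0" by (rule LIMSEQ_power_zero)
    then have "(\<lambda>R. 2 * (1 - exp (- T)) ^ R + ?B) \<longlonglongrightarrow> 2 * 0 + ?B"
      by (intro tendsto_add tendsto_mult tendsto_const)
    then show "(\<lambda>R. 2 * (1 - exp (- T)) ^ R + ?B) \<longlonglongrightarrow> ?B" by simp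
  qed (use ** in auto)
qed

text \<open>The expectation of a height is the sum of its tail. The hypothesis \<open>p T \<ge> 1\<close> absorbs the rounding of
\<open>2 p T\<close> and makes \<open>\<sigma> p T\<^sup>2\<close> dominate \<open>\<sigma> T\<close>, the expected number of blocks that originate in a single column.\<close>

lemma (in bernoulli_ballistic_deposition) expected_height:
  assumes T: "0 < T" and pT: "1 \<le> p * T"
    and W: "\<sigma> * T \<le> W" "\<sigma> * p * T\<^sup>2 \<le> 1 \<Longrightarrow> \<sigma> * p * T\<^sup>2 \<le> W"
      "1 \<le> \<sigma> * p * T\<^sup>2 \<Longrightarrow> \<sigma> * p * T\<^sup>2 \<le> W\<^sup>2" "1 \<le> \<sigma> * p * T\<^sup>2 \<Longrightarrow> 1 \<le> W"
  shows "integrable M (\<lambda>\<omega>. real (h \<omega> T 0)) \<and> expectation (\<lambda>\<omega>. real (h \<omega> T 0)) \<le> (exp 84 + 102) * W"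
proof -
  define s a where "s = \<sigma> * T" and "a = \<sigma> * p * T\<^sup>2"
  have s: "0 \<le> s" "s \<le> a"
    using \<sigma>(1) T mult_left_mono[OF pT, of "\<sigma> * T"] by (auto simp: s_def a_def power2_eq_square algebra_simps)
  obtain f F where f: "f sums F" "F \<le> (exp 84 + 102) * W" "\<And>k. 0 \<le> f k"
    "\<And>k. min 1 ((4 * s * real (Suc k) + 24 * a) ^ Suc k / (fact (Suc k))\<^sup>2 + s * (1 / 2) ^ Suc k) \<le> f k"
    using summable_tail_bound[of s W a] s W unfolding s_def a_def by blast
  have tail: "prob {\<omega> \<in> space M. k < h \<omega> T 0} \<le> f k" for k
  proof -
    let ?k = "Suc k"
    define n where "n = nat \<lceil>2 * p * T\<rceil>"
    have "real n \<le> 2 * (p * T) + 1" using T p(1) by (simp add: n_def mult.assoc)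
    then have "real (2 * ?k + 4 * n) \<le> 2 * real ?k + 12 * (p * T)"
      unfolding of_nat_add of_nat_mult of_nat_numeral using pT by linarith
    then have "2 * \<sigma> * T * real (2 * ?k + 4 * n) \<le> 2 * \<sigma> * T * (2 * real ?k + 12 * (p * T))"
      using T \<sigma>(1) by (intro mult_left_mono) auto
    also have "\<dots> = 4 * s * real ?k + 24 * a" by (simp add: s_def a_def algebra_simps power2_eq_square)
    finally have "(2 * \<sigma> * T * real (2 * ?k + 4 * n)) ^ ?k / (fact ?k)\<^sup>2
        \<le> (4 * s * real ?k + 24 * a) ^ ?k / (fact ?k)\<^sup>2"
      using T \<sigma>(1) by (intro divide_right_mono power_mono) auto
    then have "prob {\<omega> \<in> space M. ?k \<le> h \<omega> T 0} \<le> min 1 ((4 * s * real ?k + 24 * a) ^ ?k / (fact ?k)\<^sup>2 + s * (1 / 2) ^ ?k)"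
      using prob_height[OF T, of ?k] unfolding s_def n_def by simp
    also have "\<dots> \<le> f k" by (rule f(4))
    finally show ?thesis by (simp add: Suc_le_eq)
  qed
  have hm: "(\<lambda>\<omega>. h \<omega> T 0) \<in> measurable M (count_space UNIV)" using heights_measurable[of T 0] T by simp
  have "(\<integral>\<^sup>+\<omega>. ennreal (real (h \<omega> T 0)) \<partial>M) = (\<integral>\<^sup>+\<omega>. ennreal_of_enat (enat (h \<omega> T 0)) \<partial>M)"
    by (simp add: ennreal_of_nat_eq_real_of_nat)
  also have "\<dots> = (\<Sum>k. emeasure M {\<omega> \<in> space M. enat k < enat (h \<omega> T 0)})"
    by (rule nn_integral_enat_function) (rule measurable_compose[OF hm], simp)
  also have "\<dots> \<le> (\<Sum>k. ennreal (f k))"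
    using tail by (intro suminf_le) (auto simp: emeasure_eq_measure intro: ennreal_leI)
  also have "\<dots> = ennreal F"
    using f(1,3) by (simp add: suminf_ennreal2 sums_summable sums_unique[symmetric])
  finally have le: "(\<integral>\<^sup>+\<omega>. ennreal (real (h \<omega> T 0)) \<partial>M) \<le> ennreal F" .
  have meas: "(\<lambda>\<omega>. real (h \<omega> T 0)) \<in> borel_measurable M" by (rule measurable_compose[OF hm]) simp
  have int: "integrable M (\<lambda>\<omega>. real (h \<omega> T 0))"
    using le by (intro integrableI_nonneg meas) (auto intro: le_less_trans)
  have "0 \<le> F" using f(1,3) sums_le[OF _ sums_zero f(1)] by simp
  then have "expectation (\<lambda>\<omega>. real (h \<omega> T 0)) \<le> F"
    using le nn_integral_eq_integral[OF int] by simp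
  then show ?thesis using int f(2) by simp
qed

theorem theorem9p1:
  shows "\<exists>C>0. \<forall>\<zeta>\<in>{0..1}. \<forall>\<sigma>\<in>{0<..1}. \<forall>T\<ge>1. \<forall>p\<in>{T powr (- \<zeta>)..1}.
    \<forall>(M :: 'w measure) \<xi> \<epsilon> \<eta> h.
      bernoulli_ballistic_deposition M \<xi> p \<sigma> \<epsilon> \<eta> h \<longrightarrow>
        integrable M (\<lambda>\<omega>. real (h \<omega> T 0)) \<and>
        prob_space.expectation M (\<lambda>\<omega>. real (h \<omega> T 0)) \<le> C * (\<sigma> * p * T\<^sup>2) powr (1 / (2 - \<zeta>))"
proof (intro exI[of _ "exp 84 + 102"] conjI ballI allI impI)
  show "0 < exp 84 + (102 :: real)" by (simp add: add_pos_pos)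
  fix \<zeta> \<sigma> T p :: real and M :: "'w measure" and \<xi> \<epsilon> \<eta> h
  assume \<zeta>: "\<zeta> \<in> {0..1}" and \<sigma>: "\<sigma> \<in> {0<..1}" and T: "1 \<le> T" and p: "p \<in> {T powr (- \<zeta>)..1}"
    and model: "bernoulli_ballistic_deposition M \<xi> p \<sigma> \<epsilon> \<eta> h"
  interpret model: bernoulli_ballistic_deposition M \<xi> p \<sigma> \<epsilon> \<eta> h by (rule model)
  define a where "a = \<sigma> * p * T\<^sup>2"
  define g where "g = 1 / (2 - \<zeta>)"
  define W where "W = a powr g"
  have g: "1 / 2 \<le> g" "g \<le> 1" using \<zeta> by (auto simp: g_def field_simps)
  have "0 < p" using p T less_le_trans[of 0 "T powr (- \<zeta>)" p] by simp
  then have a: "0 < a" using \<sigma> T by (simp add: a_def)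
  have "1 \<le> p * T"
  proof -
    have "1 = T powr (-1) * T" using T by (simp add: powr_minus)
    also have "\<dots> \<le> p * T"
      using T p \<zeta> powr_mono[of "-1" "- \<zeta>" T] by (intro mult_right_mono) auto
    finally show ?thesis .
  qed
  moreover have "\<sigma> * T \<le> W"
  proof -
    have "\<sigma> * T \<le> \<sigma> powr g * T"
      using powr_mono'[of g 1 \<sigma>] g \<sigma> T by (intro mult_right_mono) auto
    also have "\<sigma> powr g * T = \<sigma> powr g * (T powr (2 - \<zeta>)) powr g" using T \<zeta> by (simp add: powr_powr g_def)
    also have "\<dots> = (\<sigma> * T powr (2 - \<zeta>)) powr g"
      using \<sigma> by (simp add: powr_mult)
    also have "\<dots> \<le> a powr g"
    proof (rule powr_mono2)
      have "T powr (2 - \<zeta>) = T powr (- \<zeta>) * T\<^sup>2"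
        using T powr_add[of T "- \<zeta>" 2] by (simp add: powr_numeral)
      also have "\<dots> \<le> p * T\<^sup>2" using p by (intro mult_right_mono) auto
      finally show "\<sigma> * T powr (2 - \<zeta>) \<le> a"
        using \<sigma> mult_left_mono[of "T powr (2 - \<zeta>)" "p * T\<^sup>2" \<sigma>] by (simp add: a_def mult.assoc)
    qed (use g \<sigma> in auto)
    finally show ?thesis by (simp add: W_def)
  qed
  moreover have "a \<le> W" if "a \<le> 1"
    using powr_mono'[of g 1 a] g a that by (simp add: W_def)
  moreover have "a \<le> W\<^sup>2" if "1 \<le> a"
  proof -
    have "a powr 1 \<le> a powr (g + g)" using that g by (intro powr_mono) auto
    then show ?thesis using a by (simp add: W_def power2_eq_square powr_add[symmetric])
  qed
  moreover have "1 \<le> W" if "1 \<le> a"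
    using that g by (simp add: W_def ge_one_powr_ge_zero)
  ultimately have "integrable M (\<lambda>\<omega>. real (h \<omega> T 0)) \<and> model.expectation (\<lambda>\<omega>. real (h \<omega> T 0)) \<le> (exp 84 + 102) * W"
    using T unfolding a_def by (intro model.expected_height) auto
  then show "integrable M (\<lambda>\<omega>. real (h \<omega> T 0))"
    "model.expectation (\<lambda>\<omega>. real (h \<omega> T 0)) \<le> (exp 84 + 102) * (\<sigma> * p * T\<^sup>2) powr (1 / (2 - \<zeta>))"
    by (simp_all add: W_def a_def g_def)
qed

end
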